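(* Let $q_0$ and $q_1$ be two potentials satisfying the integrability hypothesis stated in the context with the same $l\ge-\frac12$, and let $c\in(0,b)$. For $j=0,1$ let $\phi_j(z,x)$ be the real entire solution for $H_l+q_j$ which lies in the domain near $0$ and satisfies $$\phi_j(z,x)=z^{-\frac{l+1}{2}}\Big(\sin\big(\sqrt z\,x-\tfrac{l\pi}{2}\big)+o\big(e^{x|\operatorname{Im}\sqrt z|}\big)\Big)\quad\text{as }|z|\to\infty,$$ and let $\theta_j(z,x)$ be a real entire solution with $W(\theta_j(z),\phi_j(z))=1$ and $\theta_j(\cdot,x)\in R_{1/2}(\mathbb{C})$. Let $M_j(z)$ be the corresponding singular Weyl $m$-functions. If $$M_1(z)-M_0(z)=f(z)+O\big(e^{-2(c-\varepsilon)|\operatorname{Im}\sqrt z|}\big)$$ for some $f\in R_{1/2}(\mathbb{C})$ and for every $\varepsilon>0$ as $z\to\infty$ along any nonreal ray, then $q_0(x)=q_1(x)$ for (almost every) $x\in(0,c)$.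
   Context: $H_l=-\frac{d^2}{dx^2}+\frac{l(l+1)}{x^2}$ on $(0,b)$, $0<b\le\infty$, $l\ge-\frac12$, with boundary condition $\lim_{x\to0}x^l((l+1)f(x)-xf'(x))=0$ at $x=0$ for $l\in[-\frac12,\frac12)$. $H=H_l+q$ is a self-adjoint operator in $L^2(0,b)$ with the same boundary condition at $0$ as $H_l$ (and a boundary condition at $b$ if $b$ is limit circle). Hypothesis on the potential $q$: $q\in L^1_{\mathrm{loc}}(0,\infty)$ is real-valued and $x\tilde q(x)\in L^1(0,1)$, where $\tilde q=|q|$ if $l>-\frac12$ and $\tilde q(x)=(1-\log x)|q(x)|$ if $l=-\frac12$. A solution lies in the domain of $H$ near an endpoint if it is square integrable near it and satisfies the boundary condition of $H$ there in the limit circle case. Real entire solutions are solutions of $-u''+\big(\frac{l(l+1)}{x^2}+q\big)u=zu$ that are entire in $z$ and real for real $z$; solutions $\phi_j,\theta_j$ as in the claim exist. $W(u,v)=uv'-u'v$. The singular Weyl $m$-function $M(z)$, analytic in $\mathbb{C}\setminus\mathbb{R}$, is defined by requiring that $\theta(z,x)+M(z)\phi(z,x)$ lie in the domain of $H$ near $b$. $R_{1/2}(\mathbb{C})$ is the ring of entire functions $f$ with $|f(z)|\le B\exp(A|z|^{1/2})$ for some constants $A,B>0$; $\theta_j(\cdot,x)\in R_{1/2}(\mathbb{C})$ is understood for every $x$. Branch cuts are along the negative real axis. *)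

theory Defs
  imports "HOL-Analysis.Analysis" "HOL-Library.Landau_Symbols"
begin

text \<open>
  Functions on \<open>(0, b)\<close>, \<open>0 < b \<le> \<infinity>\<close>, are total functions on the reals whose values outside
  \<open>einterval 0 b\<close> are never used.  The limit \<open>x \<rightarrow> b\<close> is written as in
  \<open>HOL-Analysis.Interval_Integral\<close>, by composing with \<open>real_of_ereal\<close> and
  using the filter \<open>at_left b\<close> on the extended reals, which covers finite and infinite \<open>b\<close> alike.
\<close>

definition q_tilde :: "real \<Rightarrow> (real \<Rightarrow> real) \<Rightarrow> real \<Rightarrow> real" where
  "q_tilde l q x = (if l > - 1/2 then \<bar>q x\<bar> else (1 - ln x) * \<bar>q x\<bar>)"

definition admissible_potential :: "real \<Rightarrow> (real \<Rightarrow> real) \<Rightarrow> bool" where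
  "admissible_potential l q \<longleftrightarrow>
     (\<forall>x y. 0 < x \<longrightarrow> q absolutely_integrable_on {x..y}) \<and>
     (\<lambda>x. x * q_tilde l q x) absolutely_integrable_on {0<..<1}"

abbreviation dx :: "(real \<Rightarrow> complex) \<Rightarrow> real \<Rightarrow> complex" where
  "dx u x \<equiv> vector_derivative u (at x)"

definition wronskian :: "(real \<Rightarrow> complex) \<Rightarrow> (real \<Rightarrow> complex) \<Rightarrow> real \<Rightarrow> complex" where
  "wronskian u v x = u x * dx v x - dx u x * v x"

text \<open>
  \<open>u\<close> is differentiable on the interval \<open>I\<close>, \<open>u'\<close> is locally absolutely continuous there, and
  \<open>g\<close> represents \<open>u''\<close>.  Absolute continuity is expressed by \<open>u'\<close> being an indefinite Lebesgue
  integral, whose integrand is then determined up to a null set.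
\<close>
definition has_second_derivative_ae ::
    "(real \<Rightarrow> complex) \<Rightarrow> (real \<Rightarrow> complex) \<Rightarrow> real set \<Rightarrow> bool" where
  "has_second_derivative_ae u g I \<longleftrightarrow>
     (\<forall>x\<in>I. u differentiable (at x)) \<and>
     (\<forall>x\<in>I. \<forall>y\<in>I. x \<le> y \<longrightarrow>
        g absolutely_integrable_on {x..y} \<and> integral {x..y} g = dx u y - dx u x)"

definition potential_term :: "real \<Rightarrow> (real \<Rightarrow> real) \<Rightarrow> real \<Rightarrow> complex" where
  "potential_term l q x = complex_of_real (l * (l + 1) / x\<^sup>2 + q x)"

definition is_solution ::
    "real \<Rightarrow> (real \<Rightarrow> real) \<Rightarrow> ereal \<Rightarrow> complex \<Rightarrow> (real \<Rightarrow> complex) \<Rightarrow> bool" where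
  "is_solution l q b z u \<longleftrightarrow>
     (\<exists>g. has_second_derivative_ae u g (einterval 0 b) \<and>
          (AE x in lebesgue. x \<in> einterval 0 b \<longrightarrow>
             - g x + potential_term l q x * u x = z * u x))"

definition real_entire_solution ::
    "real \<Rightarrow> (real \<Rightarrow> real) \<Rightarrow> ereal \<Rightarrow> (complex \<Rightarrow> real \<Rightarrow> complex) \<Rightarrow> bool" where
  "real_entire_solution l q b u \<longleftrightarrow>
     (\<forall>z. is_solution l q b z (u z)) \<and>
     (\<forall>x\<in>einterval 0 b. (\<lambda>z. u z x) holomorphic_on UNIV) \<and>
     (\<forall>x\<in>einterval 0 b. \<forall>z\<in>\<real>. u z x \<in> \<real>)"

definition L2_near_left :: "ereal \<Rightarrow> (real \<Rightarrow> complex) \<Rightarrow> bool" where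
  "L2_near_left b f \<longleftrightarrow>
     (\<exists>d\<in>einterval 0 b. set_integrable lebesgue {0<..<d} (\<lambda>x. (cmod (f x))\<^sup>2))"

definition L2_near_right :: "ereal \<Rightarrow> (real \<Rightarrow> complex) \<Rightarrow> bool" where
  "L2_near_right b f \<longleftrightarrow>
     (\<exists>d\<in>einterval 0 b. set_integrable lebesgue (einterval (ereal d) b) (\<lambda>x. (cmod (f x))\<^sup>2))"

text \<open>The endpoint \<open>0\<close> is limit circle exactly when \<open>l < 1/2\<close>.\<close>
definition in_domain_near_left :: "real \<Rightarrow> ereal \<Rightarrow> (real \<Rightarrow> complex) \<Rightarrow> bool" where
  "in_domain_near_left l b f \<longleftrightarrow>
     L2_near_left b f \<and>
     (l < 1/2 \<longrightarrow>
        ((\<lambda>x. of_real (x powr l) * (of_real (l + 1) * f x - of_real x * dx f x)) \<longlongrightarrow> 0) (at_right 0))"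

definition limit_circle_right :: "real \<Rightarrow> (real \<Rightarrow> real) \<Rightarrow> ereal \<Rightarrow> bool" where
  "limit_circle_right l q b \<longleftrightarrow> (\<forall>z u. is_solution l q b z u \<longrightarrow> L2_near_right b u)"

definition wronskian_vanishes_right ::
    "ereal \<Rightarrow> (real \<Rightarrow> complex) \<Rightarrow> (real \<Rightarrow> complex) \<Rightarrow> bool" where
  "wronskian_vanishes_right b u v \<longleftrightarrow>
     ((\<lambda>x. wronskian u v (real_of_ereal x)) \<longlongrightarrow> 0) (at_left b)"

definition in_max_domain_right ::
    "real \<Rightarrow> (real \<Rightarrow> real) \<Rightarrow> ereal \<Rightarrow> (real \<Rightarrow> complex) \<Rightarrow> bool" where
  "in_max_domain_right l q b f \<longleftrightarrow>
     L2_near_right b f \<and>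
     (\<exists>g. has_second_derivative_ae f g (einterval 0 b) \<and>
          L2_near_right b (\<lambda>x. - g x + potential_term l q x * f x))"

text \<open>
  A self-adjoint (separated) boundary condition at a limit circle endpoint \<open>b\<close> is given by a real
  function \<open>w\<close> in the maximal domain near \<open>b\<close>: it reads \<open>W(w, f)(x) \<rightarrow> 0\<close> as \<open>x \<rightarrow> b\<close>, and it must
  be nontrivial, i.e. violated by some element of the maximal domain.
\<close>
definition boundary_function_right ::
    "real \<Rightarrow> (real \<Rightarrow> real) \<Rightarrow> ereal \<Rightarrow> (real \<Rightarrow> real) \<Rightarrow> bool" where
  "boundary_function_right l q b w \<longleftrightarrow>
     in_max_domain_right l q b (\<lambda>x. complex_of_real (w x)) \<and>
     (\<exists>h. in_max_domain_right l q b h \<and>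
          \<not> wronskian_vanishes_right b (\<lambda>x. complex_of_real (w x)) h)"

definition in_domain_near_right ::
    "real \<Rightarrow> (real \<Rightarrow> real) \<Rightarrow> ereal \<Rightarrow> (real \<Rightarrow> real) \<Rightarrow> (real \<Rightarrow> complex) \<Rightarrow> bool" where
  "in_domain_near_right l q b w f \<longleftrightarrow>
     L2_near_right b f \<and>
     (limit_circle_right l q b \<longrightarrow>
        wronskian_vanishes_right b (\<lambda>x. complex_of_real (w x)) f)"

definition singular_weyl_function ::
    "real \<Rightarrow> (real \<Rightarrow> real) \<Rightarrow> ereal \<Rightarrow> (real \<Rightarrow> real) \<Rightarrow> (complex \<Rightarrow> real \<Rightarrow> complex) \<Rightarrow>
     (complex \<Rightarrow> real \<Rightarrow> complex) \<Rightarrow> (complex \<Rightarrow> complex) \<Rightarrow> bool" where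
  "singular_weyl_function l q b w \<theta> \<phi> M \<longleftrightarrow>
     M holomorphic_on (- \<real>) \<and>
     (\<forall>z. z \<notin> \<real> \<longrightarrow> in_domain_near_right l q b w (\<lambda>x. \<theta> z x + M z * \<phi> z x))"

definition R_half :: "(complex \<Rightarrow> complex) set" where
  "R_half = {f. f holomorphic_on UNIV \<and>
                (\<exists>A>0. \<exists>B>0. \<forall>z. cmod (f z) \<le> B * exp (A * cmod z powr (1/2)))}"

text \<open>The asymptotics is pointwise in \<open>x\<close> and uniform in the argument of \<open>z\<close>; \<open>powr\<close> and
  \<open>csqrt\<close> are the principal branches.\<close>
definition phi_asymptotics :: "real \<Rightarrow> ereal \<Rightarrow> (complex \<Rightarrow> real \<Rightarrow> complex) \<Rightarrow> bool" where
  "phi_asymptotics l b \<phi> \<longleftrightarrow>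
     (\<forall>x\<in>einterval 0 b.
        \<exists>r \<in> o[at_infinity](\<lambda>z. complex_of_real (exp (x * \<bar>Im (csqrt z)\<bar>))).
          \<forall>\<^sub>F z in at_infinity.
            \<phi> z x = z powr (- complex_of_real ((l + 1) / 2)) *
                     (sin (csqrt z * complex_of_real x - complex_of_real (l * pi / 2)) + r z))"

end

theory Submission
  imports Defs "HOL-Complex_Analysis.Complex_Analysis" "HOL-Real_Asymp.Real_Asymp"
begin

text \<open>
  For fixed \<open>x \<in> (0, c)\<close> consider the entire function
  \<open>F z = \<phi>\<^sub>1 \<theta>\<^sub>0 - \<phi>\<^sub>0 \<theta>\<^sub>1 - f \<phi>\<^sub>0 \<phi>\<^sub>1\<close> of growth order at most \<open>1/2\<close>.  With
  \<open>\<psi>\<^sub>j = \<theta>\<^sub>j + M\<^sub>j \<phi>\<^sub>j\<close> it equals \<open>\<phi>\<^sub>1 \<psi>\<^sub>0 - \<phi>\<^sub>0 \<psi>\<^sub>1 + (M\<^sub>1 - M\<^sub>0 - f) \<phi>\<^sub>0 \<phi>\<^sub>1\<close>.  On the imaginary axis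
  the last summand decays by hypothesis, and the others do because \<open>\<phi>\<^sub>1 / \<phi>\<^sub>0\<close> tends to 1 and the
  diagonal Green function \<open>\<phi>\<^sub>j \<psi>\<^sub>j\<close> tends to 0: indeed
  \<open>1 / (\<phi> \<psi>) = \<phi>' / \<phi> - \<psi>' / \<psi>\<close>, where \<open>Im (\<psi>' / \<psi>)\<close> has the sign of \<open>Im z\<close> by Weyl's theory and
  \<open>Im (\<phi>' / \<phi>)\<close> is large with the opposite sign.  The asymptotics of \<open>\<phi>'\<close> needed here is recovered
  from the pointwise asymptotics of \<open>\<phi>\<close> at two neighbouring points.  Phragmen-Lindeloef in the two
  half planes and Liouville's theorem give \<open>F = 0\<close>.  Differentiating \<open>F = 0\<close> in \<open>x\<close> and using
  \<open>W(\<theta>\<^sub>j, \<phi>\<^sub>j) = 1\<close> yields \<open>\<phi>\<^sub>0\<^sup>2 = \<phi>\<^sub>1\<^sup>2\<close>, hence equal potentials.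
\<close>

section \<open>Absolutely continuous functions\<close>

text \<open>The Green function has to be estimated although no asymptotics of
  \<open>\<theta>\<close> or \<open>\<psi>\<close> is given. Signs replace it: two imaginary parts
  that cannot cancel bound the sum from below by the \<open>\<phi>\<close> part alone. The sign of
  the \<open>\<psi>\<close> part must hold in the limit point and the limit circle case alike, and
  is proved by contradiction: a wrong sign would persist up to \<open>b\<close>. The asymptotics of
  \<open>\<phi>\<close> is pointwise in \<open>x\<close> and cannot be differentiated. On a compact
  interval [x, y] inside (0, b) the whole potential, centrifugal term included, is an integrable
  perturbation of the free equation, and the ratio of \<open>\<phi>\<close> at \<open>y\<close> and
  \<open>x\<close> then determines its logarithmic derivative at \<open>x\<close>. Order 1/2 lies
  below 1, the critical order of a half plane, so decay on the two rays that bound the half planes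
  is enough. Dividing F = 0 by \<open>\<phi>\<^sub>0 \<phi>\<^sub>1\<close> gives
  \<open>\<theta>\<^sub>0 / \<phi>\<^sub>0 - \<theta>\<^sub>1 / \<phi>\<^sub>1 = f\<close>. The
  right side does not depend on \<open>x\<close>, and each quotient \<open>\<theta> / \<phi>\<close>
  has derivative \<open>- 1 / \<phi>\<^sup>2\<close>.\<close>

lemma absolutely_integrable_mult_continuous:
  fixes g U :: "real \<Rightarrow> 'a :: {euclidean_space, real_normed_algebra}"
  assumes "g absolutely_integrable_on {a..b}" "continuous_on {a..b} U"
  shows "(\<lambda>t. U t * g t) absolutely_integrable_on {a..b}"
    and "(\<lambda>t. g t * U t) absolutely_integrable_on {a..b}"
proof -
  have m: "U \<in> borel_measurable (lebesgue_on {a..b})"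
    using assms(2) by (intro continuous_imp_measurable_on_sets_lebesgue) auto
  have bd: "bounded (U ` {a..b})"
    using assms(2) by (intro compact_imp_bounded compact_continuous_image) auto
  have "bilinear ((*) :: 'a \<Rightarrow> _)"
    by (simp add: bilinear_conv_bounded_bilinear bounded_bilinear_mult)
  from absolutely_integrable_bounded_measurable_product[OF this m _ bd assms(1)]
  show "(\<lambda>t. U t * g t) absolutely_integrable_on {a..b}" by simp
  have "bilinear (\<lambda>x y :: 'a. y * x)"
    by (simp add: bilinear_conv_bounded_bilinear bounded_bilinear.flip bounded_bilinear_mult)
  from absolutely_integrable_bounded_measurable_product[OF this m _ bd assms(1)]
  show "(\<lambda>t. g t * U t) absolutely_integrable_on {a..b}" by simp
qed

lemma continuous_on_indefinite_integral:
  fixes g U :: "real \<Rightarrow> 'a :: euclidean_space"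
  assumes g: "g absolutely_integrable_on {a..b}"
    and U: "\<And>s t. a \<le> s \<Longrightarrow> s \<le> t \<Longrightarrow> t \<le> b \<Longrightarrow> integral {s..t} g = U t - U s"
  shows "continuous_on {a..b} U"
proof -
  have "continuous_on {a..b} (\<lambda>x. U a + integral {a..x} g)"
    by (intro continuous_intros indefinite_integral_continuous_1 set_lebesgue_integral_eq_integral g)
  moreover have "U a + integral {a..x} g = U x" if "x \<in> {a..b}" for x
    using U[of a x] that by simp
  ultimately show ?thesis by (subst continuous_on_cong[OF refl, of _ _ "\<lambda>x. U a + integral {a..x} g"]) auto
qed

text \<open>Integration by parts without differentiating almost everywhere. Let \<open>D\<close> be
  the defect of the formula. Near each point its increments are at most \<epsilon> times the
  integral of |g| + |k|, by continuity of \<open>U\<close> and \<open>V\<close>. This bound is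
  additive over adjacent intervals, so bisection carries it to [a, b]; then \<epsilon> tends to
  0.\<close>

lemma absolutely_continuous_product_rule:
  fixes U V g k :: "real \<Rightarrow> 'a :: {euclidean_space, real_normed_algebra}"
  assumes ab: "a \<le> b"
    and g: "g absolutely_integrable_on {a..b}" and k: "k absolutely_integrable_on {a..b}"
    and U: "\<And>s t. a \<le> s \<Longrightarrow> s \<le> t \<Longrightarrow> t \<le> b \<Longrightarrow> integral {s..t} g = U t - U s"
    and V: "\<And>s t. a \<le> s \<Longrightarrow> s \<le> t \<Longrightarrow> t \<le> b \<Longrightarrow> integral {s..t} k = V t - V s"
  shows "integral {a..b} (\<lambda>t. g t * V t + U t * k t) = U b * V b - U a * V a"
proof -
  note contU = continuous_on_indefinite_integral[OF g U]
  note contV = continuous_on_indefinite_integral[OF k V]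
  define h where "h = (\<lambda>t. g t * V t + U t * k t)"
  have h: "h absolutely_integrable_on {a..b}"
    unfolding h_def using g k contU contV
    by (intro set_integral_add absolutely_integrable_mult_continuous)
  define p where "p = (\<lambda>t. norm (g t) + norm (k t))"
  have p: "p absolutely_integrable_on {a..b}"
    unfolding p_def using g k by (intro set_integral_add absolutely_integrable_norm[unfolded o_def])
  define D where "D = (\<lambda>t. U t * V t - integral {a..t} h)"
  define G where "G = (\<lambda>t. integral {a..t} p)"
  have hi: "h integrable_on {s..t}" and pi: "p integrable_on {s..t}" and gi: "g integrable_on {s..t}"
    and ki: "k integrable_on {s..t}"
    if "a \<le> s" "t \<le> b" for s t
    by (rule integrable_on_subinterval[of _ "{a..b}"];
        use that h p g k in \<open>auto intro: set_lebesgue_integral_eq_integral\<close>)+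
  have inc: "norm (D b - D a) \<le> \<epsilon> * (G b - G a)" if "\<epsilon> > 0" for \<epsilon>
  proof -
    define P where "P s t \<longleftrightarrow> a \<le> s \<longrightarrow> t \<le> b \<longrightarrow> norm (D t - D s) \<le> \<epsilon> * (G t - G s)" for s t
    have "P a b"
      using ab
    proof (induction rule: Bolzano)
      case (trans x y z)
      show ?case unfolding P_def
      proof (intro impI)
        assume "a \<le> x" "z \<le> b"
        then have "norm (D y - D x) \<le> \<epsilon> * (G y - G x)" "norm (D z - D y) \<le> \<epsilon> * (G z - G y)"
          using trans by (auto simp: P_def)
        then show "norm (D z - D x) \<le> \<epsilon> * (G z - G x)"
          using norm_triangle_ineq[of "D z - D y" "D y - D x"] by (simp add: algebra_simps)
      qed
    next
      case (local x)
      then have x: "x \<in> {a..b}" by auto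
      obtain d1 where d1: "d1 > 0" "\<And>r. r \<in> {a..b} \<Longrightarrow> dist r x < d1 \<Longrightarrow> dist (U r) (U x) < \<epsilon>/2"
        using contU x \<open>\<epsilon> > 0\<close> unfolding continuous_on_iff by (metis half_gt_zero)
      obtain d2 where d2: "d2 > 0" "\<And>r. r \<in> {a..b} \<Longrightarrow> dist r x < d2 \<Longrightarrow> dist (V r) (V x) < \<epsilon>/2"
        using contV x \<open>\<epsilon> > 0\<close> unfolding continuous_on_iff by (metis half_gt_zero)
      show ?case unfolding P_def
      proof (intro exI[of _ "min d1 d2"] conjI allI impI)
        fix s t assume A: "s \<le> x \<and> x \<le> t \<and> t - s < min d1 d2" and st: "a \<le> s" "t \<le> b"
        then have le: "s \<le> t" by auto
        have near: "norm (U s - U r) \<le> \<epsilon> \<and> norm (V t - V r) \<le> \<epsilon>" if r: "r \<in> {s..t}" for r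
        proof -
          have "dist (U r) (U x) < \<epsilon>/2" "dist (U s) (U x) < \<epsilon>/2"
            using A st r by (intro d1; auto simp: dist_real_def)+
          moreover have "dist (V r) (V x) < \<epsilon>/2" "dist (V t) (V x) < \<epsilon>/2"
            using A st r by (intro d2; auto simp: dist_real_def)+
          ultimately show ?thesis
            by (smt (verit) dist_norm dist_triangle2 field_sum_of_halves)
        qed
        have "D t - D s = U t * V t - U s * V s - integral {s..t} h"
          unfolding D_def using Henstock_Kurzweil_Integration.integral_combine[where a = a and c = s and b = t and f = h] st le hi[of a t] by (simp add: algebra_simps)
        \<comment> \<open>\<open>V\<close> is frozen at the right end and \<open>U\<close> at the
          left end, which makes the splitting of the increment exact, with no quadratic
          remainder.\<close>
        also have "U t * V t - U s * V s = (U t - U s) * V t + U s * (V t - V s)"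
          by (simp add: algebra_simps)
        also have "\<dots> = integral {s..t} g * V t + U s * integral {s..t} k"
          using U V le st by simp
        also have "\<dots> = integral {s..t} (\<lambda>r. g r * V t + U s * k r)"
          using gi[of s t] ki[of s t] st le
            integral_linear[of g "{s..t}" "\<lambda>x. x * V t"] integral_linear[of k "{s..t}" "\<lambda>x. U s * x"]
          by (subst integral_add)
             (auto intro!: integrable_on_mult_left integrable_on_mult_right
                   simp: o_def bounded_linear_mult_left bounded_linear_mult_right)
        also have "\<dots> - integral {s..t} h = integral {s..t} (\<lambda>r. (g r * V t + U s * k r) - h r)"
          using gi[of s t] ki[of s t] hi[of s t] st le
          by (subst integral_diff) (auto intro!: integrable_add integrable_on_mult_left integrable_on_mult_right)
        finally have eq: "D t - D s = \<dots>" .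
        have "norm (D t - D s) \<le> integral {s..t} (\<lambda>r. \<epsilon> * p r)"
          unfolding eq
        proof (rule integral_norm_bound_integral)
          show "(\<lambda>r. g r * V t + U s * k r - h r) integrable_on {s..t}"
            using gi[of s t] ki[of s t] hi[of s t] st le
            by (auto intro!: integrable_diff integrable_add integrable_on_mult_left integrable_on_mult_right)
          show "(\<lambda>r. \<epsilon> * p r) integrable_on {s..t}"
            using pi[of s t] st le by (auto intro!: integrable_on_mult_right)
          fix r assume r: "r \<in> {s..t}"
          have "g r * V t + U s * k r - h r = g r * (V t - V r) + (U s - U r) * k r"
            by (simp add: h_def algebra_simps)
          also have "norm \<dots> \<le> norm (g r) * norm (V t - V r) + norm (U s - U r) * norm (k r)"
            by (intro norm_triangle_le add_mono norm_mult_ineq)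
          also have "\<dots> \<le> norm (g r) * \<epsilon> + \<epsilon> * norm (k r)"
            using near[OF r] \<open>\<epsilon> > 0\<close> by (intro add_mono mult_mono) auto
          finally show "norm (g r * V t + U s * k r - h r) \<le> \<epsilon> * p r"
            by (simp add: p_def algebra_simps)
        qed
        also have "\<dots> = \<epsilon> * (G t - G s)"
          unfolding G_def using Henstock_Kurzweil_Integration.integral_combine[where a = a and c = s and b = t and f = p] st le pi[of a t]
          by (simp flip: right_diff_distrib)
        finally show "norm (D t - D s) \<le> \<epsilon> * (G t - G s)" .
      qed (use d1 d2 in auto)
    qed
    then show ?thesis by (simp add: P_def)
  qed
  have "norm (D b - D a) \<le> 0"
  proof (rule field_le_epsilon)
    fix e :: real assume e: "e > 0"
    have G: "G b - G a \<ge> 0" unfolding G_def p_def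
      by (simp add: integral_nonneg pi[unfolded p_def])
    \<comment> \<open>The summand 1 keeps the denominator positive when \<open>g\<close> and
      \<open>k\<close> vanish almost everywhere.\<close>
    have "norm (D b - D a) \<le> (e / (G b - G a + 1)) * (G b - G a)"
      using e G by (intro inc) (auto intro!: divide_pos_pos)
    also have "\<dots> \<le> e" using e G by (simp add: field_simps)
    finally show "norm (D b - D a) \<le> 0 + e" by simp
  qed
  then show ?thesis by (simp add: D_def h_def algebra_simps)
qed

text \<open>Closed intervals are stable under intersection and generate the Borel sets, so the
  integral vanishes over every Borel set, then over every Lebesgue set, and a function with this
  property is zero almost everywhere.\<close>

lemma AE_zero_if_interval_integrals_zero:
  fixes h :: "real \<Rightarrow> complex"
  assumes h: "h absolutely_integrable_on {a..b}"
    and z: "\<And>s t. a \<le> s \<Longrightarrow> s \<le> t \<Longrightarrow> t \<le> b \<Longrightarrow> integral {s..t} h = 0"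
  shows "AE x in lebesgue. x \<in> {a..b} \<longrightarrow> h x = 0"
proof -
  \<comment> \<open>Extension by zero allows complements to be taken in the whole line during the
    induction over the generated sets.\<close>
  define H where "H = (\<lambda>x. indicator {a..b} x *\<^sub>R h x)"
  have H: "integrable lebesgue H" using h by (simp add: H_def set_integrable_def)
  have Hint: "set_lebesgue_integral lebesgue {s..t} H = 0" for s t
  proof -
    have "set_lebesgue_integral lebesgue {s..t} H = set_lebesgue_integral lebesgue {max a s..min b t} h"
      unfolding set_lebesgue_integral_def H_def
      by (intro Bochner_Integration.integral_cong) (auto simp: indicator_def)
    also have "\<dots> = integral {max a s..min b t} h"
      by (intro set_lebesgue_integral_eq_integral set_integrable_subset[OF h]) auto
    also have "\<dots> = 0"
      by (cases "max a s \<le> min b t") (auto intro!: z)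
    finally show ?thesis .
  qed
  have Hset: "set_lebesgue_integral lebesgue A H = 0" if "A \<in> sets borel" for A
  proof -
    have si: "set_integrable lebesgue A H" if "A \<in> sets lebesgue" for A
      using integrable_mult_indicator[OF that H] by (simp add: set_integrable_def)
    have stable: "Int_stable (range (\<lambda>(l, u). {l..u :: real}))"
      by (auto simp: Int_stable_def)
    have sub: "range (\<lambda>(l, u). {l..u :: real}) \<subseteq> Pow UNIV" by simp
    have "A \<in> sigma_sets UNIV (range (\<lambda>(l, u). {l..u :: real}))"
      using that unfolding borel_eq_atLeastAtMost by simp
    from stable sub this show ?thesis
    proof (induction rule: sigma_sets_induct_disjoint)
      case (basic A) then show ?case using Hint by auto
    next
      case empty then show ?case by (simp add: set_lebesgue_integral_def)
    next
      case (compl A)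
      have A: "A \<in> sets lebesgue" using compl(1) sets_completionI_sets[of A lborel]
        by (simp add: borel_eq_atLeastAtMost)
      have all: "set_lebesgue_integral lebesgue UNIV H = 0"
      proof -
        have "set_lebesgue_integral lebesgue UNIV H = set_lebesgue_integral lebesgue {a..b} H"
          unfolding set_lebesgue_integral_def H_def
          by (intro Bochner_Integration.integral_cong) (auto simp: indicator_def)
        then show ?thesis using Hint by simp
      qed
      have "set_lebesgue_integral lebesgue (A \<union> (UNIV - A)) H =
            set_lebesgue_integral lebesgue A H + set_lebesgue_integral lebesgue (UNIV - A) H"
        using A by (intro set_integral_Un si) (auto)
      then show ?case using all compl by simp
    next
      case (union A)
      have A: "A i \<in> sets lebesgue" for i
      proof -
        have "A i \<in> sigma_sets UNIV (range (\<lambda>(l, u). {l..u}))" using union(2) by (rule range_subsetD)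
        then show ?thesis using sets_completionI_sets[of "A i" lborel] by (simp add: borel_eq_atLeastAtMost)
      qed
      have "set_lebesgue_integral lebesgue (\<Union>i. A i) H = (\<Sum>i. set_lebesgue_integral lebesgue (A i) H)"
        using A union(1) by (intro lebesgue_integral_countable_add si) (auto simp: disjoint_family_on_def)
      then show ?case using union by simp
    qed
  qed
  interpret finite_measure "lebesgue_on {a..b}" by (simp add: finite_measure_lebesgue_on)
  have "AE x in lebesgue_on {a..b}. H x = 0"
  proof (rule density_zero)
    show "integrable (lebesgue_on {a..b}) H" using H by (simp add: integrable_restrict_space integrable_mult_indicator)
    fix A assume "A \<in> sets (lebesgue_on {a..b})"
    then have A: "A \<in> sets lebesgue" "A \<subseteq> {a..b}" by (auto simp: sets_restrict_space)
    \<comment> \<open>The induction covers Borel sets only; a Lebesgue set differs from one by a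
      subset of a null set.\<close>
    from A(1) obtain S N N' where SN: "A = S \<union> N" "N \<subseteq> N'" "N' \<in> null_sets lborel" "S \<in> sets lborel"
      by (auto elim!: sets_completionE)
    have "AE x in lebesgue. x \<notin> N'"
      using SN(3) by (intro AE_completion AE_not_in)
    then have "set_lebesgue_integral lebesgue A H = set_lebesgue_integral lebesgue S H"
      using borel_measurable_integrable[OF integrable_mult_indicator[OF _ H]] A(1) SN
      by (intro set_integral_cong_set) (auto simp: set_borel_measurable_def elim!: eventually_mono)
    also have "\<dots> = 0" using SN by (intro Hset) simp
    finally have "set_lebesgue_integral lebesgue A H = 0" .
    then show "set_lebesgue_integral (lebesgue_on {a..b}) A H = 0"
      using A by (simp add: set_lebesgue_integral_def integral_restrict_space H_def mult_ac Int_absorb1 flip: indicator_inter_arith)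
  qed
  then have "AE x in lebesgue. x \<in> {a..b} \<longrightarrow> H x = 0" by (subst (asm) AE_restrict_space_iff) auto
  then show ?thesis by eventually_elim (auto simp: H_def indicator_def)
qed

section \<open>Wronskians of solutions\<close>

lemma einterval_between:
  "x \<in> einterval a b \<Longrightarrow> y \<in> einterval a b \<Longrightarrow> x \<le> t \<Longrightarrow> t \<le> y \<Longrightarrow> t \<in> einterval a b"
  using less_le_trans[of a "ereal x" "ereal t"] le_less_trans[of "ereal t" "ereal y" b]
  by (auto simp: einterval_def)

lemma Icc_subset_einterval:
  "x \<in> einterval a b \<Longrightarrow> y \<in> einterval a b \<Longrightarrow> {x..y} \<subseteq> einterval a b"
  using einterval_between[of x a b y] by auto

context
  fixes u g :: "real \<Rightarrow> complex" and b :: ereal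
  assumes u: "has_second_derivative_ae u g (einterval 0 b)"
begin

lemma has_second_derivative_ae_imp_has_vector_derivative: "x \<in> einterval 0 b \<Longrightarrow> (u has_vector_derivative dx u x) (at x)"
  using u vector_derivative_works by (auto simp: has_second_derivative_ae_def)

lemma has_second_derivative_ae_continuous_on:
  assumes "S \<subseteq> einterval 0 b" shows "continuous_on S u"
  using assms by (meson continuous_at_imp_continuous_on has_second_derivative_ae_imp_has_vector_derivative
      has_vector_derivative_continuous subset_iff)

lemma has_second_derivative_ae_continuous_on_derivative:
  assumes "{x..y} \<subseteq> einterval 0 b" shows "continuous_on {x..y} (dx u)"
proof (cases "x \<le> y")
  case True
  then have xy: "x \<in> einterval 0 b" "y \<in> einterval 0 b" using assms by auto
  show ?thesis
  proof (rule continuous_on_indefinite_integral)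
    show "g absolutely_integrable_on {x..y}"
      using u True xy by (auto simp: has_second_derivative_ae_def)
    show "integral {s..t} g = dx u t - dx u s" if "x \<le> s" "s \<le> t" "t \<le> y" for s t
    proof -
      have "s \<in> einterval 0 b" "t \<in> einterval 0 b" using assms that True by auto
      then show ?thesis using u that by (auto simp: has_second_derivative_ae_def)
    qed
  qed
qed auto

lemma has_second_derivative_ae_ftc:
  assumes "x \<in> einterval 0 b" "y \<in> einterval 0 b" "x \<le> y"
  shows "integral {x..y} (dx u) = u y - u x"
proof (intro integral_unique fundamental_theorem_of_calculus assms(3))
  fix t assume "t \<in> {x..y}"
  then have "t \<in> einterval 0 b" using Icc_subset_einterval[OF assms(1,2)] by blast
  from has_vector_derivative_at_within[OF has_second_derivative_ae_imp_has_vector_derivative[OF this]]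
  show "(u has_vector_derivative dx u t) (at t within {x..y})" .
qed

end

text \<open>Lagrange's identity. The product rule is applied to \<open>u v'\<close> and
  \<open>u' v\<close> separately, and the common term \<open>u' v'\<close> cancels. \<open>g\<close>
  and \<open>k\<close> stay arbitrary because the identity serves solutions for different potentials
  or spectral parameters, elements of the maximal domain, and the free sine solution.\<close>

lemma wronskian_identity:
  assumes u: "has_second_derivative_ae u g (einterval 0 b)"
    and v: "has_second_derivative_ae v k (einterval 0 b)"
    and xy: "x \<in> einterval 0 b" "y \<in> einterval 0 b" "x \<le> y"
  shows "(\<lambda>t. u t * k t - g t * v t) absolutely_integrable_on {x..y}"
    and "wronskian u v y - wronskian u v x = integral {x..y} (\<lambda>t. u t * k t - g t * v t)"
proof -
  note sub = Icc_subset_einterval[OF xy(1,2)]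
  have gk: "g absolutely_integrable_on {x..y}" "k absolutely_integrable_on {x..y}"
    using u v xy by (auto simp: has_second_derivative_ae_def)
  note cont = has_second_derivative_ae_continuous_on[OF u sub] has_second_derivative_ae_continuous_on[OF v sub]
    has_second_derivative_ae_continuous_on_derivative[OF u sub] has_second_derivative_ae_continuous_on_derivative[OF v sub]
  have in_ab: "s \<in> einterval 0 b" "t \<in> einterval 0 b" if "x \<le> s" "s \<le> t" "t \<le> y" for s t
    using that sub by auto
  have int: "integral {s..t} (dx u) = u t - u s" "integral {s..t} (dx v) = v t - v s"
       "integral {s..t} g = dx u t - dx u s" "integral {s..t} k = dx v t - dx v s"
    if "x \<le> s" "s \<le> t" "t \<le> y" for s t
    using in_ab[OF that] that u v has_second_derivative_ae_ftc by (auto simp: has_second_derivative_ae_def)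
  note ai = absolutely_integrable_mult_continuous
  have dd: "dx u absolutely_integrable_on {x..y}" "dx v absolutely_integrable_on {x..y}"
    using cont by (auto intro: absolutely_integrable_continuous_real)
  have p1: "(\<lambda>t. dx u t * dx v t + u t * k t) absolutely_integrable_on {x..y}"
    by (intro set_integral_add ai dd gk cont)
  have p2: "(\<lambda>t. g t * v t + dx u t * dx v t) absolutely_integrable_on {x..y}"
    by (intro set_integral_add ai dd gk cont)
  have eq: "(\<lambda>t. u t * k t - g t * v t)
     = (\<lambda>t. (dx u t * dx v t + u t * k t) - (g t * v t + dx u t * dx v t))" by auto
  show "(\<lambda>t. u t * k t - g t * v t) absolutely_integrable_on {x..y}"
    unfolding eq by (intro set_integral_diff p1 p2)
  have i1: "integral {x..y} (\<lambda>t. dx u t * dx v t + u t * k t) = u y * dx v y - u x * dx v x"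
    using int xy dd gk by (intro absolutely_continuous_product_rule) auto
  have i2: "integral {x..y} (\<lambda>t. g t * v t + dx u t * dx v t) = dx u y * v y - dx u x * v x"
    using int xy dd gk by (intro absolutely_continuous_product_rule) auto
  show "wronskian u v y - wronskian u v x = integral {x..y} (\<lambda>t. u t * k t - g t * v t)"
    unfolding eq wronskian_def using p1 p2 i1 i2
    by (subst integral_diff) (auto intro: set_lebesgue_integral_eq_integral)
qed

lemma has_second_derivative_ae_lincomb:
  assumes u: "has_second_derivative_ae u g (einterval 0 b)"
    and v: "has_second_derivative_ae v k (einterval 0 b)"
  shows "has_second_derivative_ae (\<lambda>x. A * u x + B * v x) (\<lambda>x. A * g x + B * k x) (einterval 0 b)"
    and "x \<in> einterval 0 b \<Longrightarrow> dx (\<lambda>x. A * u x + B * v x) x = A * dx u x + B * dx v x"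
proof -
  have D: "((\<lambda>x. A * u x + B * v x) has_vector_derivative A * dx u x + B * dx v x) (at x)"
    if "x \<in> einterval 0 b" for x
    using that u v by (auto intro!: derivative_intros has_second_derivative_ae_imp_has_vector_derivative)
  then show dx: "dx (\<lambda>x. A * u x + B * v x) x = A * dx u x + B * dx v x" if "x \<in> einterval 0 b" for x
    using that vector_derivative_at by blast
  show "has_second_derivative_ae (\<lambda>x. A * u x + B * v x) (\<lambda>x. A * g x + B * k x) (einterval 0 b)"
    unfolding has_second_derivative_ae_def
  proof (intro conjI ballI impI)
    fix x assume "x \<in> einterval 0 b"
    then show "(\<lambda>x. A * u x + B * v x) differentiable at x"
      using D differentiableI_vector by blast
    fix y assume xy: "x \<in> einterval 0 b" "y \<in> einterval 0 b" "x \<le> y"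
    then have gk: "g absolutely_integrable_on {x..y}" "k absolutely_integrable_on {x..y}"
      "integral {x..y} g = dx u y - dx u x" "integral {x..y} k = dx v y - dx v x"
      using u v by (auto simp: has_second_derivative_ae_def)
    show "(\<lambda>x. A * g x + B * k x) absolutely_integrable_on {x..y}"
      by (intro set_integral_add set_integrable_mult_right gk)
    show "integral {x..y} (\<lambda>x. A * g x + B * k x) =
       dx (\<lambda>x. A * u x + B * v x) y - dx (\<lambda>x. A * u x + B * v x) x"
    proof (subst integral_add)
      show "(\<lambda>x. A * g x) integrable_on {x..y}" "(\<lambda>x. B * k x) integrable_on {x..y}"
        using gk by (auto intro!: integrable_on_mult_right set_lebesgue_integral_eq_integral)
    qed (simp add: dx xy gk(3,4) right_diff_distrib)
  qed
qed

lemma has_second_derivative_ae_cnj: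
  assumes u: "has_second_derivative_ae u g (einterval 0 b)"
  shows "has_second_derivative_ae (\<lambda>x. cnj (u x)) (\<lambda>x. cnj (g x)) (einterval 0 b)"
    and "x \<in> einterval 0 b \<Longrightarrow> dx (\<lambda>x. cnj (u x)) x = cnj (dx u x)"
proof -
  have D: "((\<lambda>x. cnj (u x)) has_vector_derivative cnj (dx u x)) (at x)"
    if "x \<in> einterval 0 b" for x
    using that u by (auto intro!: derivative_intros has_second_derivative_ae_imp_has_vector_derivative)
  then show dx: "dx (\<lambda>x. cnj (u x)) x = cnj (dx u x)" if "x \<in> einterval 0 b" for x
    using that vector_derivative_at by blast
  show "has_second_derivative_ae (\<lambda>x. cnj (u x)) (\<lambda>x. cnj (g x)) (einterval 0 b)"
    unfolding has_second_derivative_ae_def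
  proof (intro conjI ballI impI)
    fix x assume "x \<in> einterval 0 b"
    then show "(\<lambda>x. cnj (u x)) differentiable at x"
      using D differentiableI_vector by blast
    fix y assume xy: "x \<in> einterval 0 b" "y \<in> einterval 0 b" "x \<le> y"
    then have gk: "g absolutely_integrable_on {x..y}" "integral {x..y} g = dx u y - dx u x"
      using u by (auto simp: has_second_derivative_ae_def)
    show "(\<lambda>x. cnj (g x)) absolutely_integrable_on {x..y}"
      using absolutely_integrable_linear[OF gk(1) bounded_linear_cnj] by (simp add: o_def)
    show "integral {x..y} (\<lambda>x. cnj (g x)) = dx (\<lambda>x. cnj (u x)) y - dx (\<lambda>x. cnj (u x)) x"
      using integral_linear[OF set_lebesgue_integral_eq_integral(1)[OF gk(1)] bounded_linear_cnj] gk xy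
      by (simp add: o_def dx)
  qed
qed

section \<open>Solutions of the differential equation\<close>

text \<open>Integrals ignore null sets, so the unknown representative of the second derivative can
  be exchanged for the one that the equation prescribes.\<close>

lemma is_solution_iff:
  "is_solution l q b z u \<longleftrightarrow>
     has_second_derivative_ae u (\<lambda>x. (potential_term l q x - z) * u x) (einterval 0 b)"
proof
  assume "is_solution l q b z u"
  then obtain g where g: "has_second_derivative_ae u g (einterval 0 b)"
    and ae: "AE x in lebesgue. x \<in> einterval 0 b \<longrightarrow> - g x + potential_term l q x * u x = z * u x"
    by (auto simp: is_solution_def)
  define N where "N = {x. \<not> (x \<in> einterval 0 b \<longrightarrow> - g x + potential_term l q x * u x = z * u x)}"
  have N: "negligible N" using ae unfolding N_def by (simp add: eventually_ae_filter_negligible) (metis (mono_tags, lifting) Collect_subset mem_Collect_eq negligible_subset subsetI)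
  have eq: "(potential_term l q x - z) * u x = g x" if "x \<in> einterval 0 b - N" for x
    using that by (auto simp: N_def algebra_simps)
  show "has_second_derivative_ae u (\<lambda>x. (potential_term l q x - z) * u x) (einterval 0 b)"
    unfolding has_second_derivative_ae_def
  proof (intro conjI ballI impI)
    fix x assume "x \<in> einterval 0 b"
    then show "u differentiable at x" using g by (auto simp: has_second_derivative_ae_def)
    fix y assume xy: "x \<in> einterval 0 b" "y \<in> einterval 0 b" "x \<le> y"
    note sub = Icc_subset_einterval[OF xy(1,2)]
    have gk: "g absolutely_integrable_on {x..y}" "integral {x..y} g = dx u y - dx u x"
      using g xy by (auto simp: has_second_derivative_ae_def)
    show "(\<lambda>x. (potential_term l q x - z) * u x) absolutely_integrable_on {x..y}"
      by (rule absolutely_integrable_spike[OF gk(1) N]) (use sub eq in auto)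
    have "integral {x..y} (\<lambda>x. (potential_term l q x - z) * u x) = integral {x..y} g"
      by (rule integral_spike[OF N]) (use sub eq in auto)
    then show "integral {x..y} (\<lambda>x. (potential_term l q x - z) * u x) = dx u y - dx u x"
      using gk by simp
  qed
next
  assume "has_second_derivative_ae u (\<lambda>x. (potential_term l q x - z) * u x) (einterval 0 b)"
  then show "is_solution l q b z u"
    unfolding is_solution_def by (intro exI conjI) (auto simp: algebra_simps)
qed

lemma is_solution_lincomb:
  assumes "is_solution l q b z u" "is_solution l q b z v"
  shows "is_solution l q b z (\<lambda>x. A * u x + B * v x)"
  using has_second_derivative_ae_lincomb(1)[OF assms[unfolded is_solution_iff], of A B]
  by (simp add: is_solution_iff algebra_simps)

lemma is_solution_cnj:
  assumes "is_solution l q b z u"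
  shows "is_solution l q b (cnj z) (\<lambda>x. cnj (u x))"
  using has_second_derivative_ae_cnj(1)[OF assms[unfolded is_solution_iff]]
  by (simp add: is_solution_iff potential_term_def)

lemma dx_lincomb_solution:
  assumes "is_solution l q b z u" "is_solution l q b z v" "x \<in> einterval 0 b"
  shows "dx (\<lambda>x. A * u x + B * v x) x = A * dx u x + B * dx v x"
  using has_second_derivative_ae_lincomb(2)[OF assms(1,2)[unfolded is_solution_iff] assms(3)] .

lemma dx_cnj_solution:
  assumes "is_solution l q b z u" "x \<in> einterval 0 b"
  shows "dx (\<lambda>x. cnj (u x)) x = cnj (dx u x)"
  using has_second_derivative_ae_cnj(2)[OF assms(1)[unfolded is_solution_iff] assms(2)] .

lemma wronskian_solutions:
  assumes "is_solution l q b z u" "is_solution l q b z' v"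
    and xy: "x \<in> einterval 0 b" "y \<in> einterval 0 b" "x \<le> y"
  shows "wronskian u v y - wronskian u v x = (z - z') * integral {x..y} (\<lambda>t. u t * v t)"
proof -
  have "wronskian u v y - wronskian u v x = integral {x..y} (\<lambda>t. (z - z') * (u t * v t))"
    using wronskian_identity(2)[OF assms(1,2)[unfolded is_solution_iff] xy]
    by (simp add: algebra_simps)
  then show ?thesis by simp
qed

lemma solution_continuous_on:
  assumes "is_solution l q b z u" "S \<subseteq> einterval 0 b"
  shows "continuous_on S u"
  using has_second_derivative_ae_continuous_on assms by (auto simp: is_solution_iff)

lemma solution_continuous_on_derivative:
  assumes "is_solution l q b z u" "{x..y} \<subseteq> einterval 0 b"
  shows "continuous_on {x..y} (dx u)"
  using has_second_derivative_ae_continuous_on_derivative assms by (auto simp: is_solution_iff)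

text \<open>Taking the supremum of \<open>N\<close> on both sides replaces Gronwall's inequality when the kernel has
  total mass at most \<open>1/2\<close>.\<close>
lemma bounded_by_small_kernel:
  fixes N \<rho> :: "real \<Rightarrow> real"
  assumes xy: "x \<le> y" and N: "continuous_on {x..y} N"
    and \<rho>: "\<rho> absolutely_integrable_on {x..y}" "\<And>t. t \<in> {x..y} \<Longrightarrow> \<rho> t \<ge> 0"
    and small: "integral {x..y} \<rho> \<le> 1/2"
    and le: "\<And>s. s \<in> {x..y} \<Longrightarrow> N s \<le> K + integral {x..s} (\<lambda>t. \<rho> t * N t)"
    and K: "K \<ge> 0" and t: "t \<in> {x..y}"
  shows "N t \<le> 2 * K"
proof -
  have "\<exists>m\<in>{x..y}. \<forall>s\<in>{x..y}. N s \<le> N m"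
    using xy by (intro continuous_attains_sup N) auto
  then obtain m where m: "m \<in> {x..y}" "\<And>s. s \<in> {x..y} \<Longrightarrow> N s \<le> N m" by blast
  have "N m \<le> 2 * K"
  proof (cases "N m \<le> 0")
    case False
    have \<rho>i: "\<rho> integrable_on {x..s}" if "s \<in> {x..y}" for s
      using that by (intro integrable_on_subinterval[OF set_lebesgue_integral_eq_integral(1)[OF \<rho>(1)]]) auto
    have "N m \<le> K + integral {x..m} (\<lambda>t. \<rho> t * N t)" using le m by auto
    also have "integral {x..m} (\<lambda>t. \<rho> t * N t) \<le> integral {x..m} (\<lambda>t. \<rho> t * N m)"
    proof (rule integral_le)
      have "(\<lambda>t. \<rho> t * N t) absolutely_integrable_on {x..m}"
        using m(1)
        by (intro absolutely_integrable_mult_continuous absolutely_integrable_on_subinterval[OF \<rho>(1)]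
              continuous_on_subset[OF N]) auto
      then show "(\<lambda>t. \<rho> t * N t) integrable_on {x..m}"
        using set_lebesgue_integral_eq_integral(1) by blast
      show "(\<lambda>t. \<rho> t * N m) integrable_on {x..m}"
        using \<rho>i[OF m(1)] by (rule integrable_on_mult_left)
    qed (use m \<rho>(2) in \<open>auto intro!: mult_left_mono\<close>)
    also have "\<dots> = integral {x..m} \<rho> * N m" by simp
    also have "integral {x..m} \<rho> \<le> integral {x..y} \<rho>"
      using m \<rho>i xy \<rho>(2) by (intro integral_subset_le) auto
    then have "integral {x..m} \<rho> * N m \<le> 1/2 * N m"
      using small False by (intro mult_right_mono) auto
    finally show ?thesis by simp
  qed (use K in auto)
  then show ?thesis using m(2)[OF t] by simp
qed

section \<open>A Phragmen-Lindeloef argument\<close>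

lemma R_halfI:
  assumes "f holomorphic_on UNIV" "A > 0" "B > 0"
    and "\<And>z. cmod (f z) \<le> B * exp (A * cmod z powr (1/2))"
  shows "f \<in> R_half"
  using assms by (auto simp: R_half_def)

lemma R_half_mult:
  assumes "f \<in> R_half" "g \<in> R_half"
  shows "(\<lambda>z. f z * g z) \<in> R_half"
proof -
  obtain A B A' B' where AB: "A > 0" "B > 0" "\<And>z. cmod (f z) \<le> B * exp (A * cmod z powr (1/2))"
    "A' > 0" "B' > 0" "\<And>z. cmod (g z) \<le> B' * exp (A' * cmod z powr (1/2))"
    using assms by (auto simp: R_half_def)
  have "cmod (f z * g z) \<le> (B * B') * exp ((A + A') * cmod z powr (1/2))" for z
    using mult_mono[OF AB(3)[of z] AB(6)[of z]] AB by (simp add: norm_mult algebra_simps exp_add)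
  then show ?thesis using assms AB
    by (intro R_halfI[of _ "A + A'" "B * B'"]) (auto intro!: holomorphic_intros simp: R_half_def)
qed

lemma R_half_diff:
  assumes "f \<in> R_half" "g \<in> R_half"
  shows "(\<lambda>z. f z - g z) \<in> R_half"
proof -
  obtain A B A' B' where AB: "A > 0" "B > 0" "\<And>z. cmod (f z) \<le> B * exp (A * cmod z powr (1/2))"
    "A' > 0" "B' > 0" "\<And>z. cmod (g z) \<le> B' * exp (A' * cmod z powr (1/2))"
    using assms by (auto simp: R_half_def)
  have "cmod (f z - g z) \<le> (B + B') * exp ((A + A') * cmod z powr (1/2))" for z
  proof -
    have "cmod (f z - g z) \<le> B * exp (A * cmod z powr (1/2)) + B' * exp (A' * cmod z powr (1/2))"
      using AB(3)[of z] AB(6)[of z] norm_triangle_ineq4[of "f z" "g z"] by linarith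
    also have "\<dots> \<le> B * exp ((A + A') * cmod z powr (1/2)) + B' * exp ((A + A') * cmod z powr (1/2))"
      using AB by (intro add_mono mult_left_mono) (auto simp: algebra_simps)
    finally show ?thesis by (simp add: algebra_simps)
  qed
  then show ?thesis using assms AB
    by (intro R_halfI[of _ "A + A'" "B + B'"]) (auto intro!: holomorphic_intros simp: R_half_def)
qed

text \<open>The exponent lies strictly between the growth order 1/2 and 1: in the right half plane
  the power then has argument at most 3 pi / 8 < pi / 2, hence a real part comparable to its
  modulus. The shift by 1 moves the branch point out of the closed half plane.\<close>

lemma Re_powr_three_quarters_ge:
  assumes "Re z \<ge> 0"
  shows "Re ((1 + z) powr of_real (3/4)) \<ge> cos (3 * pi / 8) * cmod z powr (3/4)"
proof -
  have nz: "1 + z \<noteq> 0" using assms by (metis add.right_neutral add_nonneg_eq_0_iff one_complex.sel(1) plus_complex.sel(1) zero_complex.sel(1) zero_le_one zero_neq_one)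
  have arg: "\<bar>Arg (1 + z)\<bar> \<le> pi / 2"
  proof -
    have "Re (1 + z) > 0" using assms by simp
    then have "\<bar>Im (Ln (1 + z))\<bar> < pi / 2" using nz Re_Ln_pos_lt by blast
    then show ?thesis using nz by (simp add: Arg_eq_Im_Ln)
  qed
  have "(1 + z) powr of_real (3/4) = exp (of_real (3/4) * Ln (1 + z))"
    using nz by (simp add: powr_def)
  then have "Re ((1 + z) powr of_real (3/4)) = exp (3/4 * ln (cmod (1 + z))) * cos (3/4 * Arg (1 + z))"
    using nz by (simp add: Re_exp Arg_eq_Im_Ln)
  also have "exp (3/4 * ln (cmod (1 + z))) = cmod (1 + z) powr (3/4)"
    using nz by (simp add: powr_def)
  also have "cos (3/4 * Arg (1 + z)) = cos \<bar>3/4 * Arg (1 + z)\<bar>" by (simp only: cos_abs_real)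
  also have "cmod (1 + z) powr (3/4) * \<dots> \<ge> cmod z powr (3/4) * cos (3 * pi / 8)"
  proof (intro mult_mono powr_mono2)
    show "cos (3 * pi / 8) \<le> cos \<bar>3/4 * Arg (1 + z)\<bar>"
      using arg by (intro cos_monotone_0_pi_le) (auto simp: abs_mult)
    have "(cmod z)\<^sup>2 \<le> (cmod (1 + z))\<^sup>2"
      using assms unfolding cmod_power2 by (simp add: power2_eq_square algebra_simps)
    then show "cmod z \<le> cmod (1 + z)" by (rule power2_le_imp_le) simp
    show "0 \<le> cos (3 * pi / 8)" by (intro cos_ge_zero) auto
  qed auto
  finally show ?thesis by (simp add: mult.commute)
qed

text \<open>\<open>F\<close> is damped by exp (- \<epsilon> (1 + z)^(3/4)), which has modulus at
  most 1 on the imaginary axis. The maximum principle on a large half disc bounds the product by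
  \<open>K\<close>, and \<epsilon> tends to 0 at the fixed point \<open>z0\<close>.\<close>

lemma phragmen_lindelof_right_half_plane:
  assumes F: "F \<in> R_half" and K: "K > 0"
    and axis: "\<And>y. cmod (F (\<i> * of_real y)) \<le> K" and z0: "Re z0 \<ge> 0"
  shows "cmod (F z0) \<le> K"
proof (cases "Re z0 = 0")
  case True
  then have "z0 = \<i> * of_real (Im z0)" by (simp add: complex_eq_iff)
  then show ?thesis using axis by metis
next
  case False
  obtain A B where AB: "A > 0" "B > 0" "\<And>z. cmod (F z) \<le> B * exp (A * cmod z powr (1/2))"
    and hol: "F holomorphic_on UNIV"
    using F by (auto simp: R_half_def)
  define \<gamma> where "\<gamma> = cos (3 * pi / 8)"
  have \<gamma>: "\<gamma> > 0" unfolding \<gamma>_def by (intro cos_gt_zero_pi) auto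
  have step: "cmod (F z0) \<le> K * exp (\<epsilon> * Re ((1 + z0) powr of_real (3/4)))" if \<epsilon>: "\<epsilon> > 0" for \<epsilon> :: real
  proof -
    define G where "G = (\<lambda>z. F z * exp (- of_real \<epsilon> * (1 + z) powr of_real (3/4)))"
    have G: "cmod (G z) = cmod (F z) * exp (- \<epsilon> * Re ((1 + z) powr of_real (3/4)))" for z
      by (simp add: G_def norm_mult)
    \<comment> \<open>On the arc of radius R the damping of order 3/4 beats the growth of order 1/2,
      which provides the radius of the half disc.\<close>
    have "((\<lambda>R. B * exp (A * R powr (1/2) - \<epsilon> * \<gamma> * R powr (3/4))) \<longlongrightarrow> 0) at_top"
      using AB \<epsilon> \<gamma> by real_asymp
    then have "\<forall>\<^sub>F R in at_top. B * exp (A * R powr (1/2) - \<epsilon> * \<gamma> * R powr (3/4)) < K"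
      using K by (auto dest: order_tendstoD)
    moreover have "\<forall>\<^sub>F R in at_top. R > cmod z0" by (rule eventually_gt_at_top)
    ultimately have "\<forall>\<^sub>F R in at_top. B * exp (A * R powr (1/2) - \<epsilon> * \<gamma> * R powr (3/4)) < K \<and> R > cmod z0"
      by eventually_elim auto
    then obtain R where R: "B * exp (A * R powr (1/2) - \<epsilon> * \<gamma> * R powr (3/4)) < K" "R > cmod z0"
      by (auto simp: eventually_at_top_linorder)
    define S where "S = ball 0 R \<inter> {z. Re z > 0}"
    have opS: "open S" unfolding S_def by (intro open_Int open_ball open_halfspace_Re_gt)
    have clS: "closure S \<subseteq> cball 0 R \<inter> {z. Re z \<ge> 0}"
      unfolding S_def by (intro closure_minimal closed_Int closed_cball closed_halfspace_Re_ge) auto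
    have holG: "G holomorphic_on {z. Re z > -1}"
      unfolding G_def
      by (intro holomorphic_intros holomorphic_on_subset[OF hol]) (auto simp: complex_nonpos_Reals_iff)
    have "cmod (G z0) \<le> K"
    proof (rule maximum_modulus_frontier[of G S])
      show "G holomorphic_on interior S"
        by (rule holomorphic_on_subset[OF holG]) (use interior_subset[of S] in \<open>auto simp: S_def\<close>)
      show "continuous_on (closure S) G"
        by (rule holomorphic_on_imp_continuous_on, rule holomorphic_on_subset[OF holG])
           (use clS in \<open>force\<close>)
      show "bounded S" unfolding S_def by (intro bounded_Int) simp
      show "z0 \<in> S" using R False z0 by (auto simp: S_def)
      fix z assume "z \<in> frontier S"
      then have z: "z \<in> closure S" "z \<notin> S" using opS by (auto simp: frontier_def interior_open)
      then have z': "cmod z \<le> R" "Re z \<ge> 0" using clS by auto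
      have low: "Re ((1 + z) powr of_real (3/4)) \<ge> \<gamma> * cmod z powr (3/4)"
        using Re_powr_three_quarters_ge[OF z'(2)] by (simp add: \<gamma>_def)
      show "cmod (G z) \<le> K"
      proof (cases "Re z = 0")
        case True
        then have "z = \<i> * of_real (Im z)" by (simp add: complex_eq_iff)
        then have "cmod (F z) \<le> K" using axis by metis
        moreover have "Re ((1 + z) powr of_real (3/4)) \<ge> 0"
          using low \<gamma> by (smt (verit) mult_nonneg_nonneg powr_ge_zero)
        then have "exp (- \<epsilon> * Re ((1 + z) powr of_real (3/4))) \<le> 1"
          using \<epsilon> by simp
        ultimately show ?thesis unfolding G using K
          by (smt (verit) exp_ge_zero mult_left_le mult_right_mono norm_ge_zero)
      next
        case False
        then have "cmod z = R" using z z' by (auto simp: S_def)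
        have "cmod (G z) \<le> (B * exp (A * R powr (1/2))) * exp (- \<epsilon> * (\<gamma> * R powr (3/4)))"
          unfolding G using AB(3)[of z] low \<epsilon> AB(2) \<open>cmod z = R\<close> by (intro mult_mono) auto
        also have "\<dots> = B * exp (A * R powr (1/2) - \<epsilon> * \<gamma> * R powr (3/4))"
          by (simp add: exp_diff exp_minus field_simps)
        finally show ?thesis using R by simp
      qed
    qed
    then show ?thesis unfolding G by (simp add: exp_minus field_simps)
  qed
  have "((\<lambda>\<epsilon>. K * exp (\<epsilon> * Re ((1 + z0) powr of_real (3/4)))) \<longlongrightarrow> K * exp (0 * Re ((1 + z0) powr of_real (3/4)))) (at_right 0)"
    by (intro tendsto_intros)
  then have lim: "((\<lambda>\<epsilon>. K * exp (\<epsilon> * Re ((1 + z0) powr of_real (3/4)))) \<longlongrightarrow> K) (at_right 0)" by simp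
  have "\<forall>\<^sub>F \<epsilon> in at_right (0 :: real). \<epsilon> > 0" by (rule eventually_at_right_less)
  then have "\<forall>\<^sub>F \<epsilon> in at_right (0 :: real). cmod (F z0) \<le> K * exp (\<epsilon> * Re ((1 + z0) powr of_real (3/4)))"
    by eventually_elim (rule step)
  from tendsto_lowerbound[OF lim this trivial_limit_at_right_real] show ?thesis .
qed

text \<open>The two limits bound \<open>F\<close> on the whole imaginary axis. The left half plane
  is treated through F (- z), so \<open>F\<close> is bounded and by Liouville constant; the constant
  is its limit along the upper ray.\<close>

lemma R_half_eq_0:
  assumes F: "F \<in> R_half"
    and up: "((\<lambda>t. F (\<i> * of_real t)) \<longlongrightarrow> 0) at_top"
    and down: "((\<lambda>t. F (- \<i> * of_real t)) \<longlongrightarrow> 0) at_top"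
  shows "F z = 0"
proof -
  have hol: "F holomorphic_on UNIV" using F by (auto simp: R_half_def)
  have "\<forall>\<^sub>F t in at_top. cmod (F (\<i> * of_real t)) < 1 \<and> cmod (F (- \<i> * of_real t)) < 1"
    using order_tendstoD(2)[OF tendsto_norm[OF up], of 1] order_tendstoD(2)[OF tendsto_norm[OF down], of 1]
    by (intro eventually_conj) simp_all
  then obtain T where T: "\<And>t. t \<ge> T \<Longrightarrow> cmod (F (\<i> * of_real t)) < 1 \<and> cmod (F (- \<i> * of_real t)) < 1"
    by (auto simp: eventually_at_top_linorder)
  have "compact ((\<lambda>y. F (\<i> * of_real y)) ` {-T..T})"
    by (intro compact_continuous_image continuous_on_compose2[OF holomorphic_on_imp_continuous_on[OF hol]]
         continuous_intros) auto
  then obtain C where C: "\<And>y. y \<in> {-T..T} \<Longrightarrow> cmod (F (\<i> * of_real y)) \<le> C"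
    using compact_imp_bounded bounded_iff by (metis (no_types, lifting) imageI)
  define K where "K = max C 1"
  have K: "K > 0" by (simp add: K_def)
  have axis: "cmod (F (\<i> * of_real y)) \<le> K" for y
  proof (cases "y \<in> {-T..T}")
    case False
    then consider "y \<ge> T" | "- y \<ge> T" by (auto simp: not_le)
    then show ?thesis using T[of y] T[of "- y"] by cases (auto simp: K_def)
  qed (use C[of y] in \<open>auto simp: K_def\<close>)
  have Fm: "(\<lambda>z. F (- z)) \<in> R_half"
  proof -
    obtain A B where "A > 0" "B > 0" "\<And>z. cmod (F z) \<le> B * exp (A * cmod z powr (1/2))"
      using F by (auto simp: R_half_def)
    then have "cmod (F (- z)) \<le> B * exp (A * cmod z powr (1/2))" for z
      by (metis norm_minus_cancel)
    moreover have "(\<lambda>z. F (- z)) holomorphic_on UNIV"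
      using holomorphic_on_compose_gen[of uminus UNIV F UNIV] hol
      by (simp add: o_def holomorphic_on_minus)
    ultimately show ?thesis using \<open>A > 0\<close> \<open>B > 0\<close> by (intro R_halfI)
  qed
  have "cmod (F w) \<le> K" for w
  proof (cases "Re w \<ge> 0")
    case False
    have "cmod (F (- (\<i> * of_real y))) \<le> K" for y using axis[of "- y"] by simp
    from phragmen_lindelof_right_half_plane[OF Fm K this, of "- w"] False show ?thesis by simp
  qed (use phragmen_lindelof_right_half_plane[OF F K axis] in auto)
  then have "bounded (range F)" by (auto simp: bounded_iff)
  from Liouville_theorem[OF hol this] obtain c where c: "\<And>z. F z = c"
    by (auto simp: constant_on_def)
  then have "c = 0" using up by (simp add: tendsto_const_iff)
  then show ?thesis using c by simp
qed

section \<open>Square integrability near the right endpoint\<close>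

lemma L2_near_rightE:
  assumes "L2_near_right b f"
  obtains d C where "d \<in> einterval 0 b"
    "\<And>x y. d \<le> x \<Longrightarrow> y \<in> einterval 0 b \<Longrightarrow> (\<lambda>t. (cmod (f t))\<^sup>2) absolutely_integrable_on {x..y}"
    "\<And>x y. d \<le> x \<Longrightarrow> y \<in> einterval 0 b \<Longrightarrow> integral {x..y} (\<lambda>t. (cmod (f t))\<^sup>2) \<le> C"
proof -
  define F where "F = (\<lambda>t. (cmod (f t))\<^sup>2)"
  obtain d where d: "d \<in> einterval 0 b" "F absolutely_integrable_on einterval (ereal d) b"
    using assms by (auto simp: L2_near_right_def F_def)
  \<comment> \<open>The integrability interval is open at \<open>d\<close>. Starting at a point
    \<open>e\<close> beyond \<open>d\<close> keeps the compact intervals [x, y] inside it.\<close>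
  obtain e where e: "ereal d < ereal e" "ereal e < b"
    using d(1) ereal_dense2[of "ereal d" b] by (auto simp: einterval_def)
  show thesis
  proof
    show "e \<in> einterval 0 b" using d(1) e by (auto simp: einterval_def intro: less_trans)
    fix x y assume xy: "e \<le> x" "y \<in> einterval 0 b"
    have sub: "{x..y} \<subseteq> einterval (ereal d) b"
    proof
      fix t assume "t \<in> {x..y}"
      then show "t \<in> einterval (ereal d) b"
        using xy e le_less_trans[of "ereal t" "ereal y" b] by (auto simp: einterval_def)
    qed
    then show ai: "(\<lambda>t. (cmod (f t))\<^sup>2) absolutely_integrable_on {x..y}"
      using set_integrable_subset[OF d(2)] by (auto simp: F_def)
    show "integral {x..y} (\<lambda>t. (cmod (f t))\<^sup>2) \<le> integral (einterval (ereal d) b) (\<lambda>t. (cmod (f t))\<^sup>2)"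
      using sub ai d(2) unfolding F_def
      by (intro integral_subset_le) (auto intro: set_lebesgue_integral_eq_integral)
  qed
qed

text \<open>Exhausting (d, b) by compact intervals gives an increasing sequence of integrals bounded
  by \<open>C\<close>; its convergence makes the nonnegative integrand integrable up to
  \<open>b\<close>.\<close>

lemma L2_near_rightI:
  assumes f: "continuous_on (einterval 0 b) f" and d: "d \<in> einterval 0 b"
    and C: "\<And>y. y \<in> einterval 0 b \<Longrightarrow> d \<le> y \<Longrightarrow> integral {d..y} (\<lambda>t. (cmod (f t))\<^sup>2) \<le> C"
  shows "L2_near_right b f"
proof -
  define F where "F = (\<lambda>t. (cmod (f t))\<^sup>2)"
  have db: "ereal d < b" using d by (auto simp: einterval_def)
  have sub: "einterval (ereal d) b \<subseteq> einterval 0 b"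
    using d by (auto simp: einterval_def)
  have contF: "continuous_on (einterval 0 b) F"
    unfolding F_def by (intro continuous_intros f)
  obtain u l where approx: "einterval (ereal d) b = (\<Union>i. {l i .. u i})"
    "incseq u" "decseq l" "\<And>i. l i < u i" "\<And>i. ereal d < l i" "\<And>i. u i < b"
    "l \<longlonglongrightarrow> ereal d" "u \<longlonglongrightarrow> b"
    by (rule einterval_Icc_approximation[OF db]) (rule that)
  have subi: "{l i..u i} \<subseteq> einterval (ereal d) b" for i using approx(1) by auto
  have contFi: "continuous_on {l i..u i} F" for i
    using contF sub subi by (meson continuous_on_subset)
  have int: "set_integrable lborel {l i..u i} F" for i
    using contFi borel_integrable_atLeastAtMost' by blast
  have Fi: "F integrable_on {s..t}" if "s \<in> einterval 0 b" "t \<in> einterval 0 b" for s t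
    using continuous_on_subset[OF contF Icc_subset_einterval[OF that]] integrable_continuous_real by blast
  have ui: "u i \<in> einterval 0 b" "l i \<in> einterval 0 b" "d < l i" for i
    using subset_trans[OF subi[of i] sub] approx(4,5)[of i] by (auto simp: subset_iff less_imp_le)
  have lb: "(LBINT x=l i..u i. F x) = integral {l i..u i} F" for i
    using int[of i] approx(4)[of i] by (intro interval_integral_eq_integral) auto
  have "\<exists>L. (\<lambda>i. LBINT x=l i..u i. F x) \<longlonglongrightarrow> L"
  proof -
    have inc: "incseq (\<lambda>i. integral {l i..u i} F)"
    proof (rule incseq_SucI)
      fix i
      have "l (Suc i) \<le> l i" "u i \<le> u (Suc i)"
        using approx(2,3) by (auto simp: incseq_Suc_iff decseq_Suc_iff)
      then show "integral {l i..u i} F \<le> integral {l (Suc i)..u (Suc i)} F"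
        using ui by (intro integral_subset_le Fi) (auto simp: F_def)
    qed
    have "integral {l i..u i} F \<le> C" for i
    proof -
      have "integral {l i..u i} F \<le> integral {d..u i} F"
        using ui[of i] d by (intro integral_subset_le Fi) (auto simp: F_def)
      also have "\<dots> \<le> C" unfolding F_def using ui[of i] approx(4)[of i] by (intro C) auto
      finally show ?thesis .
    qed
    then obtain L where "(\<lambda>i. integral {l i..u i} F) \<longlonglongrightarrow> L"
      using incseq_convergent[OF inc, of C] by metis
    then show ?thesis unfolding lb ..
  qed
  then obtain L where L: "(\<lambda>i. LBINT x=l i..u i. F x) \<longlonglongrightarrow> L" by blast
  have meas: "set_borel_measurable lborel (einterval (ereal d) b) F"
    using borel_measurable_continuous_on_indicator[OF _ continuous_on_subset[OF contF sub]]
    by (simp add: set_borel_measurable_def)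
  have "set_integrable lborel (einterval (ereal d) b) F"
    by (rule interval_integral_Icc_approx_nonneg(1)[OF db approx int _ meas L]) (auto simp: F_def)
  then have "set_integrable lebesgue (einterval (ereal d) b) F"
    using meas by (simp add: set_integrable_def set_borel_measurable_def integrable_completion)
  then show ?thesis using d unfolding L2_near_right_def F_def by blast
qed

text \<open>The tail starts where the increasing, bounded integral function is within \<epsilon> of
  its supremum. Small tails supply the small total mass that \<open>bounded_by_small_kernel\<close>
  asks for.\<close>

lemma L2_near_right_small_tail:
  assumes f: "L2_near_right b f" and \<epsilon>: "\<epsilon> > 0" and x0: "x0 \<in> einterval 0 b"
  obtains d where "d \<in> einterval 0 b" "x0 \<le> d"
    "\<And>x y. d \<le> x \<Longrightarrow> y \<in> einterval 0 b \<Longrightarrow> (\<lambda>t. (cmod (f t))\<^sup>2) absolutely_integrable_on {x..y}"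
    "\<And>x y. d \<le> x \<Longrightarrow> y \<in> einterval 0 b \<Longrightarrow> integral {x..y} (\<lambda>t. (cmod (f t))\<^sup>2) \<le> \<epsilon>"
proof -
  define F where "F = (\<lambda>t. (cmod (f t))\<^sup>2)"
  obtain c C where c: "c \<in> einterval 0 b"
    and F: "\<And>x y. c \<le> x \<Longrightarrow> y \<in> einterval 0 b \<Longrightarrow> F absolutely_integrable_on {x..y}"
    and C: "\<And>x y. c \<le> x \<Longrightarrow> y \<in> einterval 0 b \<Longrightarrow> integral {x..y} F \<le> C"
    by (rule L2_near_rightE[OF f, folded F_def]) (rule that)
  define X where "X = {y \<in> einterval 0 b. c \<le> y}"
  define G where "G y = integral {c..y} F" for y
  have bdd: "bdd_above (G ` X)" unfolding G_def X_def by (rule bdd_aboveI[of _ C]) (auto intro: C)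
  have ne: "X \<noteq> {}" using c by (auto simp: X_def)
  obtain e where e: "e \<in> X" "G e > (SUP y\<in>X. G y) - \<epsilon>"
    using less_cSUP_iff[OF ne bdd, of "(SUP y\<in>X. G y) - \<epsilon>"] \<epsilon> by auto
  show thesis
  proof
    show "max e x0 \<in> einterval 0 b" "x0 \<le> max e x0" using e x0 by (auto simp: X_def max_def)
    fix x y assume xy: "max e x0 \<le> x" "y \<in> einterval 0 b"
    then have cx: "c \<le> x" using e by (auto simp: X_def)
    show "(\<lambda>t. (cmod (f t))\<^sup>2) absolutely_integrable_on {x..y}"
      using F[OF cx xy(2)] by (simp add: F_def)
    have "integral {x..y} F \<le> \<epsilon>"
    proof (cases "x \<le> y")
      case True
      have Fi: "F integrable_on {c..y}"
        using F[of c y] xy by (auto intro: set_lebesgue_integral_eq_integral)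
      have ey: "e \<le> x" "c \<le> e" using xy e by (auto simp: X_def)
      have "G e + integral {e..y} F = G y"
        unfolding G_def using Fi ey True by (intro Henstock_Kurzweil_Integration.integral_combine) auto
      moreover have "integral {x..y} F \<le> integral {e..y} F"
        using ey xy F[of x y] F[of e y] by (intro integral_subset_le) (auto intro: set_lebesgue_integral_eq_integral simp: F_def)
      moreover have "G y \<le> (SUP y\<in>X. G y)"
        using xy ey True by (intro cSUP_upper bdd) (auto simp: X_def)
      ultimately show ?thesis using e by simp
    qed (use \<epsilon> in auto)
    then show "integral {x..y} (\<lambda>t. (cmod (f t))\<^sup>2) \<le> \<epsilon>" by (simp add: F_def)
  qed
qed

lemma L2_near_right_cnj: "L2_near_right b f \<Longrightarrow> L2_near_right b (\<lambda>x. cnj (f x))"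
  by (simp add: L2_near_right_def)

text \<open>With T = - h'' + V h, Lagrange's identity makes - u T + z u h the derivative of W(u, h),
  and products of square integrable functions are integrable.\<close>

lemma wronskian_bounded_near_right:
  assumes u: "is_solution l q b z u" "L2_near_right b u" and h: "in_max_domain_right l q b h"
  obtains d C where "d \<in> einterval 0 b" "\<And>y. y \<in> einterval 0 b \<Longrightarrow> d \<le> y \<Longrightarrow> cmod (wronskian u h y) \<le> C"
proof -
  obtain g where hL: "L2_near_right b h" and g: "has_second_derivative_ae h g (einterval 0 b)"
    and \<tau>: "L2_near_right b (\<lambda>x. - g x + potential_term l q x * h x)"
    using h by (auto simp: in_max_domain_right_def)
  define T where "T = (\<lambda>x. - g x + potential_term l q x * h x)"
  obtain d1 C1 where d1: "d1 \<in> einterval 0 b"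
    "\<And>x y. d1 \<le> x \<Longrightarrow> y \<in> einterval 0 b \<Longrightarrow> (\<lambda>t. (cmod (u t))\<^sup>2) absolutely_integrable_on {x..y}"
    "\<And>x y. d1 \<le> x \<Longrightarrow> y \<in> einterval 0 b \<Longrightarrow> integral {x..y} (\<lambda>t. (cmod (u t))\<^sup>2) \<le> C1"
    by (rule L2_near_rightE[OF u(2)]) (rule that)
  obtain d2 C2 where d2: "d2 \<in> einterval 0 b"
    "\<And>x y. d2 \<le> x \<Longrightarrow> y \<in> einterval 0 b \<Longrightarrow> (\<lambda>t. (cmod (h t))\<^sup>2) absolutely_integrable_on {x..y}"
    "\<And>x y. d2 \<le> x \<Longrightarrow> y \<in> einterval 0 b \<Longrightarrow> integral {x..y} (\<lambda>t. (cmod (h t))\<^sup>2) \<le> C2"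
    by (rule L2_near_rightE[OF hL]) (rule that)
  obtain d3 C3 where d3: "d3 \<in> einterval 0 b"
    "\<And>x y. d3 \<le> x \<Longrightarrow> y \<in> einterval 0 b \<Longrightarrow> (\<lambda>t. (cmod (T t))\<^sup>2) absolutely_integrable_on {x..y}"
    "\<And>x y. d3 \<le> x \<Longrightarrow> y \<in> einterval 0 b \<Longrightarrow> integral {x..y} (\<lambda>t. (cmod (T t))\<^sup>2) \<le> C3"
    by (rule L2_near_rightE[OF \<tau>[folded T_def]]) (rule that)
  define d where "d = max d1 (max d2 d3)"
  have d: "d \<in> einterval 0 b" "d1 \<le> d" "d2 \<le> d" "d3 \<le> d" using d1 d2 d3 by (auto simp: d_def max_def)
  define K where "K = C1 + C3 + cmod z * (C1 + C2)"
  have "cmod (wronskian u h y) \<le> cmod (wronskian u h d) + K" if y: "y \<in> einterval 0 b" "d \<le> y" for y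
  proof -
    let ?I = "\<lambda>t. u t * g t - (potential_term l q t - z) * u t * h t"
    let ?P = "\<lambda>t. (cmod (u t))\<^sup>2 + (cmod (T t))\<^sup>2 + cmod z * ((cmod (u t))\<^sup>2 + (cmod (h t))\<^sup>2)"
    note W = wronskian_identity[OF u(1)[unfolded is_solution_iff] g d(1) y]
    have ints: "(\<lambda>t. (cmod (u t))\<^sup>2) integrable_on {d..y}" "(\<lambda>t. (cmod (h t))\<^sup>2) integrable_on {d..y}"
       "(\<lambda>t. (cmod (T t))\<^sup>2) integrable_on {d..y}"
      using d1(2) d2(2) d3(2) d y by (auto intro!: set_lebesgue_integral_eq_integral)
    have "cmod (integral {d..y} ?I) \<le> integral {d..y} ?P"
    proof (rule integral_norm_bound_integral)
      show "?I integrable_on {d..y}" using W(1) set_lebesgue_integral_eq_integral(1) by blast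
      show "?P integrable_on {d..y}"
        by (intro integrable_add integrable_on_mult_right ints)
      fix t
      have am: "r * s \<le> r\<^sup>2 + s\<^sup>2" if "0 \<le> r" "0 \<le> s" for r s :: real
        using mult_nonneg_nonneg[OF that] sum_squares_bound[of r s] by simp
      have "?I t = - (u t * T t) + z * (u t * h t)" by (simp add: T_def algebra_simps)
      also have "cmod \<dots> \<le> cmod (u t) * cmod (T t) + cmod z * (cmod (u t) * cmod (h t))"
        by (metis (no_types, lifting) norm_minus_cancel norm_mult norm_triangle_ineq)
      also have "\<dots> \<le> ?P t" by (intro add_mono mult_left_mono am) auto
      finally show "cmod (?I t) \<le> ?P t" .
    qed
    also have "\<dots> = integral {d..y} (\<lambda>t. (cmod (u t))\<^sup>2) + integral {d..y} (\<lambda>t. (cmod (T t))\<^sup>2)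
        + cmod z * (integral {d..y} (\<lambda>t. (cmod (u t))\<^sup>2) + integral {d..y} (\<lambda>t. (cmod (h t))\<^sup>2))"
      by (simp add: integral_add ints integrable_add integrable_on_mult_right)
    also have "\<dots> \<le> K" unfolding K_def using d1(3) d2(3) d3(3) d y
      by (intro add_mono mult_left_mono) auto
    finally have "cmod (wronskian u h y - wronskian u h d) \<le> K" using W(2) by simp
    then show ?thesis using norm_triangle_sub[of "wronskian u h y" "wronskian u h d"] by linarith
  qed
  then show thesis using that d(1) by blast
qed

section \<open>The boundary form of a Weyl solution and Weyl's alternative at
  \<open>b\<close>\<close>

lemma continuous_on_wronskian:
  assumes "is_solution l q b z u" "is_solution l' q' b z' v" "{x..y} \<subseteq> einterval 0 b"
  shows "continuous_on {x..y} (wronskian u v)"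
  unfolding wronskian_def[abs_def]
  using assms by (intro continuous_intros solution_continuous_on solution_continuous_on_derivative)

text \<open>Connects the boundary form with the imaginary part of the logarithmic derivative. The
  product with the conjugate replaces the quotient so that zeros of \<open>u\<close> need no
  exception.\<close>

lemma wronskian_cnj_self:
  assumes "is_solution l q b z u" "x \<in> einterval 0 b"
  shows "wronskian u (\<lambda>t. cnj (u t)) x = - 2 * \<i> * of_real (Im (dx u x * cnj (u x)))"
proof -
  have "dx u x * cnj (u x) - cnj (dx u x * cnj (u x)) = 2 * \<i> * of_real (Im (dx u x * cnj (u x)))"
    by (simp add: complex_eq_iff algebra_simps)
  then show ?thesis
    using dx_cnj_solution[OF assms] by (simp add: wronskian_def algebra_simps)
qed

text \<open>Used with a majorant \<open>P\<close> that itself contains the Wronskian to be bounded;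
  this gives an integral inequality for \<open>bounded_by_small_kernel\<close>.\<close>

lemma wronskian_bound_by_kernel:
  assumes u: "is_solution l q b z u" and v: "is_solution l q b z' v"
    and xy: "x \<in> einterval 0 b" "y \<in> einterval 0 b" "x \<le> y"
    and P: "continuous_on {x..y} P" and le: "\<And>t. t \<in> {x..y} \<Longrightarrow> cmod (u t) * cmod (v t) \<le> P t"
  shows "cmod (wronskian u v y) \<le> cmod (wronskian u v x) + cmod (z - z') * integral {x..y} P"
proof -
  have "cmod (integral {x..y} (\<lambda>t. u t * v t)) \<le> integral {x..y} P"
    using solution_continuous_on[OF u Icc_subset_einterval[OF xy(1,2)]]
      solution_continuous_on[OF v Icc_subset_einterval[OF xy(1,2)]] P le
    by (intro integral_norm_bound_integral integrable_continuous_real continuous_intros)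
       (auto simp: norm_mult)
  then have "cmod (wronskian u v y - wronskian u v x) \<le> cmod (z - z') * integral {x..y} P"
    unfolding wronskian_solutions[OF u v xy] by (simp add: norm_mult mult_left_mono)
  then show ?thesis using norm_triangle_sub[of "wronskian u v y" "wronskian u v x"] by linarith
qed

text \<open>If the boundary form of an \<open>L\<^sup>2\<close> solution \<open>\<psi>\<close> stays away from zero, then \<open>\<psi>\<close> and its conjugate
  form a fundamental system for \<open>\<tau> - z\<close> up to an integrable error, so that every solution inherits
  square integrability from \<open>\<psi>\<close>.\<close>
lemma L2_near_right_if_wronskian_cnj_bounded_below:
  assumes \<psi>: "is_solution l q b z \<psi>" "L2_near_right b \<psi>" and \<phi>: "is_solution l q b z \<phi>"
    and W1: "\<And>x. x \<in> einterval 0 b \<Longrightarrow> wronskian \<psi> \<phi> x = 1"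
    and x0: "x0 \<in> einterval 0 b" and \<delta>: "\<delta> > 0"
    and low: "\<And>y. y \<in> einterval 0 b \<Longrightarrow> x0 \<le> y \<Longrightarrow> cmod (wronskian \<psi> (\<lambda>t. cnj (\<psi> t)) y) \<ge> \<delta>"
  shows "L2_near_right b \<phi>"
proof -
  define \<eta> where "\<eta> = cmod (z - cnj z)"
  define S where "S = (\<lambda>t. (cmod (\<psi> t))\<^sup>2)"
  define \<psi>' where "\<psi>' = (\<lambda>t. cnj (\<psi> t))"
  note sol' = is_solution_cnj[OF \<psi>(1), folded \<psi>'_def]
  \<comment> \<open>With a tail of this size the kernel \<eta> / \<delta> * S has mass at most 1/2;
    the summand 1 covers \<eta> = 0.\<close>
  have "1 / (2 * (\<eta> / \<delta> + 1)) > 0" using \<delta> by (simp add: \<eta>_def add_nonneg_pos)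
  then obtain d where d: "d \<in> einterval 0 b" "x0 \<le> d"
    and dS: "\<And>y. y \<in> einterval 0 b \<Longrightarrow> integral {d..y} S \<le> 1 / (2 * (\<eta> / \<delta> + 1))"
    using L2_near_right_small_tail[OF \<psi>(2) _ x0, folded S_def] by (metis order_refl)
  define A where "A = wronskian \<phi> \<psi>'"
  define K where "K = cmod (A d) + 1"
  have contS: "continuous_on X S" if "X \<subseteq> einterval 0 b" for X
    unfolding S_def using that by (intro continuous_intros solution_continuous_on[OF \<psi>(1)])
  have \<phi>_le: "cmod (\<phi> t) \<le> (cmod (A t) + 1) * cmod (\<psi> t) / \<delta>" if t: "t \<in> einterval 0 b" "d \<le> t" for t
  proof -
    \<comment> \<open>Cramer's rule: \<phi> in the basis formed by \<psi> and its conjugate. The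
      coefficient of the conjugate has numerator W(\<psi>, \<phi>) = 1, so only \<open>A\<close> has
      to be controlled.\<close>
    have "\<phi> t * wronskian \<psi> \<psi>' t = A t * \<psi> t + \<psi>' t * wronskian \<psi> \<phi> t"
      unfolding A_def wronskian_def by (simp add: algebra_simps)
    then have "cmod (\<phi> t) * cmod (wronskian \<psi> \<psi>' t) = cmod (A t * \<psi> t + \<psi>' t)"
      using W1[OF t(1)] by (metis norm_mult mult.right_neutral)
    also have "\<dots> \<le> (cmod (A t) + 1) * cmod (\<psi> t)"
      by (rule order_trans[OF norm_triangle_ineq]) (simp add: norm_mult \<psi>'_def algebra_simps)
    finally have "cmod (\<phi> t) * \<delta> \<le> (cmod (A t) + 1) * cmod (\<psi> t)"
      using low[OF t(1)] t(2) d(2) mult_left_mono[of \<delta> "cmod (wronskian \<psi> \<psi>' t)" "cmod (\<phi> t)"]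
      by (simp add: \<psi>'_def)
    then show ?thesis using \<delta> by (simp add: field_simps)
  qed
  \<comment> \<open>Adding 1 to |A| absorbs the term with the conjugate of \<psi>, so that the
    integral inequality becomes homogeneous.\<close>
  have A_le: "cmod (A y) + 1 \<le> 2 * K" if y: "y \<in> einterval 0 b" "d \<le> y" for y
  proof (rule bounded_by_small_kernel[where x = d and y = y and \<rho> = "\<lambda>t. \<eta> / \<delta> * S t"
        and N = "\<lambda>y. cmod (A y) + 1"])
    note sub = Icc_subset_einterval[OF d(1) y(1)]
    show cA: "continuous_on {d..y} (\<lambda>y. cmod (A y) + 1)"
      unfolding A_def by (intro continuous_intros continuous_on_wronskian[OF \<phi> sol' sub])
    show "(\<lambda>t. \<eta> / \<delta> * S t) absolutely_integrable_on {d..y}"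
      using sub by (intro absolutely_integrable_continuous_real continuous_intros contS)
    show "integral {d..y} (\<lambda>t. \<eta> / \<delta> * S t) \<le> 1/2"
    proof -
      have "integral {d..y} (\<lambda>t. \<eta> / \<delta> * S t) = \<eta> / \<delta> * integral {d..y} S" by simp
      also have "\<dots> \<le> \<eta> / \<delta> * (1 / (2 * (\<eta> / \<delta> + 1)))"
        using dS[OF y(1)] \<delta> by (intro mult_left_mono) (auto simp: \<eta>_def)
      also have "\<dots> \<le> 1/2" using \<delta> by (simp add: \<eta>_def divide_simps add_nonneg_pos)
      finally show ?thesis .
    qed
    fix s assume s: "s \<in> {d..y}"
    then have sI: "s \<in> einterval 0 b" using sub by auto
    note subs = Icc_subset_einterval[OF d(1) sI]
    have "cmod (A s) \<le> cmod (A d) + \<eta> * integral {d..s} (\<lambda>t. S t / \<delta> * (cmod (A t) + 1))"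
      unfolding A_def \<eta>_def
    proof (rule wronskian_bound_by_kernel[OF \<phi> sol' d(1) sI], goal_cases)
      case 2
      show ?case using \<delta>
        by (intro continuous_intros contS subs continuous_on_wronskian[OF \<phi> sol' subs]) auto
    next
      case (3 t)
      then have t: "t \<in> einterval 0 b" "d \<le> t" using subs by auto
      have "cmod (\<phi> t) * cmod (\<psi>' t) \<le> (cmod (A t) + 1) * cmod (\<psi> t) / \<delta> * cmod (\<psi> t)"
        using mult_right_mono[OF \<phi>_le[OF t], of "cmod (\<psi> t)"] by (simp add: \<psi>'_def)
      then show ?case by (simp add: S_def power2_eq_square A_def mult_ac)
    qed (use s in auto)
    also have "\<eta> * integral {d..s} (\<lambda>t. S t / \<delta> * (cmod (A t) + 1)) =
        integral {d..s} (\<lambda>t. \<eta> * (S t / \<delta> * (cmod (A t) + 1)))" by simp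
    finally show "cmod (A s) + 1 \<le> K + integral {d..s} (\<lambda>t. \<eta> / \<delta> * S t * (cmod (A t) + 1))"
      by (simp add: K_def mult_ac)
  qed (use y \<delta> in \<open>auto simp: K_def S_def \<eta>_def\<close>)
  show ?thesis
  proof (rule L2_near_rightI)
    show "continuous_on (einterval 0 b) \<phi>" using solution_continuous_on[OF \<phi>] by simp
    fix y assume y: "y \<in> einterval 0 b" "d \<le> y"
    note sub = Icc_subset_einterval[OF d(1) y(1)]
    have "integral {d..y} (\<lambda>t. (cmod (\<phi> t))\<^sup>2) \<le> integral {d..y} (\<lambda>t. (2 * K / \<delta>)\<^sup>2 * S t)"
    proof (rule integral_le)
      show "(\<lambda>t. (cmod (\<phi> t))\<^sup>2) integrable_on {d..y}" "(\<lambda>t. (2 * K / \<delta>)\<^sup>2 * S t) integrable_on {d..y}"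
        using sub \<delta> by (intro integrable_continuous_real continuous_intros contS
            solution_continuous_on[OF \<phi>]; simp)+
      fix t assume "t \<in> {d..y}"
      then have t: "t \<in> einterval 0 b" "d \<le> t" using sub by auto
      have "cmod (\<phi> t) \<le> 2 * K * cmod (\<psi> t) / \<delta>"
        using \<phi>_le[OF t] A_le[OF t] \<delta>
        by (smt (verit) divide_right_mono mult_right_mono norm_ge_zero)
      then have "(cmod (\<phi> t))\<^sup>2 \<le> (2 * K * cmod (\<psi> t) / \<delta>)\<^sup>2" by (intro power_mono) auto
      then show "(cmod (\<phi> t))\<^sup>2 \<le> (2 * K / \<delta>)\<^sup>2 * S t"
        by (simp add: S_def power_mult_distrib power_divide)
    qed
    also have "\<dots> \<le> (2 * K / \<delta>)\<^sup>2 * (1 / (2 * (\<eta> / \<delta> + 1)))"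
      using mult_left_mono[OF dS[OF y(1)], of "(2 * K / \<delta>)\<^sup>2"] by simp
    finally show "integral {d..y} (\<lambda>t. (cmod (\<phi> t))\<^sup>2) \<le> \<dots>" .
  qed (fact d)
qed

text \<open>Weyl's theorem that square integrability of all solutions passes from one spectral
  parameter to every other. In the basis \<psi>, \<phi> at \<open>z\<close>, a solution
  \<open>v\<close> at z' has Wronskians as coefficients; these vary only through (z' - z) v times a
  basis solution and hence stay bounded near \<open>b\<close>.\<close>

lemma limit_circle_right_if_all_L2:
  assumes \<psi>: "is_solution l q b z \<psi>" "L2_near_right b \<psi>"
    and \<phi>: "is_solution l q b z \<phi>" "L2_near_right b \<phi>"
    and W1: "\<And>x. x \<in> einterval 0 b \<Longrightarrow> wronskian \<psi> \<phi> x = 1" and x0: "x0 \<in> einterval 0 b"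
  shows "limit_circle_right l q b"
  unfolding limit_circle_right_def
proof (intro allI impI)
  fix z' v assume v: "is_solution l q b z' v"
  define \<eta> where "\<eta> = cmod (z' - z)"
  define S where "S = (\<lambda>t. (cmod (\<psi> t))\<^sup>2 + (cmod (\<phi> t))\<^sup>2)"
  \<comment> \<open>Two such tails give \<open>S\<close> mass at most 1 / (4 (\<eta> + 1)), and the
    kernel 2 \<eta> S then has mass at most 1/2.\<close>
  have pos: "1 / (8 * (\<eta> + 1)) > 0" by (simp add: \<eta>_def add_nonneg_pos)
  obtain d1 where d1: "d1 \<in> einterval 0 b" "x0 \<le> d1"
    and d1S: "\<And>x y. d1 \<le> x \<Longrightarrow> y \<in> einterval 0 b \<Longrightarrow> integral {x..y} (\<lambda>t. (cmod (\<psi> t))\<^sup>2) \<le> 1 / (8 * (\<eta> + 1))"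
    using L2_near_right_small_tail[OF \<psi>(2) pos x0] by metis
  obtain d2 where d2: "d2 \<in> einterval 0 b" "x0 \<le> d2"
    and d2S: "\<And>x y. d2 \<le> x \<Longrightarrow> y \<in> einterval 0 b \<Longrightarrow> integral {x..y} (\<lambda>t. (cmod (\<phi> t))\<^sup>2) \<le> 1 / (8 * (\<eta> + 1))"
    using L2_near_right_small_tail[OF \<phi>(2) pos x0] by metis
  define d where "d = max d1 d2"
  have d: "d \<in> einterval 0 b" "d1 \<le> d" "d2 \<le> d" using d1 d2 by (auto simp: d_def max_def)
  note cont = solution_continuous_on[OF \<psi>(1)] solution_continuous_on[OF \<phi>(1)] solution_continuous_on[OF v]
  have contS: "continuous_on X S" if "X \<subseteq> einterval 0 b" for X
    unfolding S_def using that by (intro continuous_intros cont)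
  have dS: "integral {d..y} S \<le> 1 / (4 * (\<eta> + 1))" if y: "y \<in> einterval 0 b" for y
  proof -
    note sub = Icc_subset_einterval[OF d(1) y(1)]
    have "integral {d..y} S = integral {d..y} (\<lambda>t. (cmod (\<psi> t))\<^sup>2) + integral {d..y} (\<lambda>t. (cmod (\<phi> t))\<^sup>2)"
      unfolding S_def using sub
      by (intro integral_add integrable_continuous_real continuous_intros cont)
    also have "\<dots> \<le> 1 / (8 * (\<eta> + 1)) + 1 / (8 * (\<eta> + 1))"
      using d1S[OF d(2) y] d2S[OF d(3) y] by (rule add_mono)
    also have "\<dots> = 1 / (4 * (\<eta> + 1))" using pos by (simp add: divide_simps)
    finally show ?thesis .
  qed
  define N where "N = (\<lambda>t. cmod (wronskian v \<phi> t) + cmod (wronskian v \<psi> t))"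
  have v_le: "cmod (v t) \<le> N t * (cmod (\<psi> t) + cmod (\<phi> t))" if t: "t \<in> einterval 0 b" for t
  proof -
    \<comment> \<open>Expansion of \<open>v\<close> in the basis \<psi>, \<phi>, whose Wronskian is
      1.\<close>
    have "v t * wronskian \<psi> \<phi> t = wronskian v \<phi> t * \<psi> t - wronskian v \<psi> t * \<phi> t"
      unfolding wronskian_def by (simp add: algebra_simps)
    then have "cmod (v t) = cmod (wronskian v \<phi> t * \<psi> t - wronskian v \<psi> t * \<phi> t)"
      using W1[OF t] by simp
    also have "\<dots> \<le> cmod (wronskian v \<phi> t) * cmod (\<psi> t) + cmod (wronskian v \<psi> t) * cmod (\<phi> t)"
      by (metis norm_mult norm_triangle_ineq4)
    also have "\<dots> \<le> N t * (cmod (\<psi> t) + cmod (\<phi> t))"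
      unfolding N_def by (simp add: algebra_simps)
    finally show ?thesis .
  qed
  have sq: "(cmod (\<psi> t) + cmod (\<phi> t))\<^sup>2 \<le> 2 * S t" for t
    unfolding S_def using sum_squares_bound[of "cmod (\<psi> t)" "cmod (\<phi> t)"]
    by (simp add: power2_sum)
  have contN: "continuous_on {x..y} N" if "{x..y} \<subseteq> einterval 0 b" for x y
    unfolding N_def using that
    by (intro continuous_intros continuous_on_wronskian[OF v \<phi>(1)] continuous_on_wronskian[OF v \<psi>(1)])
  have N_le: "N y \<le> 2 * N d" if y: "y \<in> einterval 0 b" "d \<le> y" for y
  proof (rule bounded_by_small_kernel[where x = d and y = y and \<rho> = "\<lambda>t. 2 * \<eta> * S t" and N = N])
    note sub = Icc_subset_einterval[OF d(1) y(1)]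
    show "continuous_on {d..y} N" using contN[OF sub] .
    show "(\<lambda>t. 2 * \<eta> * S t) absolutely_integrable_on {d..y}"
      using sub by (intro absolutely_integrable_continuous_real continuous_intros contS)
    show "integral {d..y} (\<lambda>t. 2 * \<eta> * S t) \<le> 1/2"
    proof -
      have "integral {d..y} (\<lambda>t. 2 * \<eta> * S t) = 2 * \<eta> * integral {d..y} S" by simp
      also have "\<dots> \<le> 2 * \<eta> * (1 / (4 * (\<eta> + 1)))"
        using dS[OF y(1)] by (intro mult_left_mono) (auto simp: \<eta>_def)
      also have "\<dots> \<le> 1/2" by (simp add: \<eta>_def divide_simps add_nonneg_pos)
      finally show ?thesis .
    qed
    fix s assume s: "s \<in> {d..y}"
    then have sI: "s \<in> einterval 0 b" using sub by auto
    note subs = Icc_subset_einterval[OF d(1) sI]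
    let ?P1 = "\<lambda>t. cmod (v t) * cmod (\<phi> t)" and ?P2 = "\<lambda>t. cmod (v t) * cmod (\<psi> t)"
    have cP: "continuous_on {d..s} ?P1" "continuous_on {d..s} ?P2"
      using subs by (intro continuous_intros cont; simp)+
    have "cmod (wronskian v \<phi> s) \<le> cmod (wronskian v \<phi> d) + \<eta> * integral {d..s} ?P1"
      unfolding \<eta>_def using s by (intro wronskian_bound_by_kernel[OF v \<phi>(1) d(1) sI] cP) auto
    moreover have "cmod (wronskian v \<psi> s) \<le> cmod (wronskian v \<psi> d) + \<eta> * integral {d..s} ?P2"
      unfolding \<eta>_def using s by (intro wronskian_bound_by_kernel[OF v \<psi>(1) d(1) sI] cP) auto
    ultimately have "N s \<le> N d + \<eta> * (integral {d..s} ?P1 + integral {d..s} ?P2)"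
      unfolding N_def by (simp add: algebra_simps)
    also have "integral {d..s} ?P1 + integral {d..s} ?P2 = integral {d..s} (\<lambda>t. ?P1 t + ?P2 t)"
      using cP by (intro integral_add[symmetric] integrable_continuous_real)
    also have "\<dots> \<le> integral {d..s} (\<lambda>t. 2 * S t * N t)"
    proof (rule integral_le)
      show "(\<lambda>t. ?P1 t + ?P2 t) integrable_on {d..s}"
        using cP by (intro integrable_continuous_real continuous_on_add)
      show "(\<lambda>t. 2 * S t * N t) integrable_on {d..s}"
        using subs by (intro integrable_continuous_real continuous_intros contS contN)
      fix t assume "t \<in> {d..s}"
      then have t: "t \<in> einterval 0 b" using subs by auto
      have "?P1 t + ?P2 t = cmod (v t) * (cmod (\<psi> t) + cmod (\<phi> t))" by (simp add: algebra_simps)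
      also have "\<dots> \<le> N t * (cmod (\<psi> t) + cmod (\<phi> t)) * (cmod (\<psi> t) + cmod (\<phi> t))"
        using v_le[OF t] by (intro mult_right_mono) auto
      also have "\<dots> = N t * (cmod (\<psi> t) + cmod (\<phi> t))\<^sup>2" by (simp add: power2_eq_square)
      also have "\<dots> \<le> N t * (2 * S t)" using sq by (intro mult_left_mono) (auto simp: N_def)
      finally show "?P1 t + ?P2 t \<le> 2 * S t * N t" by (simp add: mult_ac)
    qed
    finally have "N s \<le> N d + \<eta> * integral {d..s} (\<lambda>t. 2 * S t * N t)"
      by (simp add: \<eta>_def mult_left_mono)
    also have "\<eta> * integral {d..s} (\<lambda>t. 2 * S t * N t) = integral {d..s} (\<lambda>t. \<eta> * (2 * S t * N t))"
      by (rule integral_mult_right[symmetric])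
    finally show "N s \<le> N d + integral {d..s} (\<lambda>t. 2 * \<eta> * S t * N t)"
      by (simp add: mult_ac)
  qed (use y in \<open>auto simp: N_def S_def \<eta>_def\<close>)
  show "L2_near_right b v"
  proof (rule L2_near_rightI)
    show "continuous_on (einterval 0 b) v" using solution_continuous_on[OF v] by simp
    fix y assume y: "y \<in> einterval 0 b" "d \<le> y"
    note sub = Icc_subset_einterval[OF d(1) y(1)]
    have "integral {d..y} (\<lambda>t. (cmod (v t))\<^sup>2) \<le> integral {d..y} (\<lambda>t. 8 * (N d)\<^sup>2 * S t)"
    proof (rule integral_le)
      show "(\<lambda>t. (cmod (v t))\<^sup>2) integrable_on {d..y}" "(\<lambda>t. 8 * (N d)\<^sup>2 * S t) integrable_on {d..y}"
        using sub by (intro integrable_continuous_real continuous_intros contS cont; simp)+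
      fix t assume "t \<in> {d..y}"
      then have t: "t \<in> einterval 0 b" "d \<le> t" using sub by auto
      have "cmod (v t) \<le> 2 * N d * (cmod (\<psi> t) + cmod (\<phi> t))"
        using v_le[OF t(1)] N_le[OF t]
        by (smt (verit) mult_right_mono norm_ge_zero)
      then have "(cmod (v t))\<^sup>2 \<le> (2 * N d * (cmod (\<psi> t) + cmod (\<phi> t)))\<^sup>2" by (intro power_mono) auto
      also have "\<dots> = 4 * (N d)\<^sup>2 * (cmod (\<psi> t) + cmod (\<phi> t))\<^sup>2" by (simp add: power_mult_distrib)
      also have "\<dots> \<le> 4 * (N d)\<^sup>2 * (2 * S t)" using sq by (intro mult_left_mono) auto
      finally show "(cmod (v t))\<^sup>2 \<le> 8 * (N d)\<^sup>2 * S t" by simp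
    qed
    also have "\<dots> \<le> 8 * (N d)\<^sup>2 * (1 / (4 * (\<eta> + 1)))"
      using mult_left_mono[OF dS[OF y(1)], of "8 * (N d)\<^sup>2"] by simp
    finally show "integral {d..y} (\<lambda>t. (cmod (v t))\<^sup>2) \<le> \<dots>" .
  qed (fact d)
qed

text \<open>The Pluecker identity transfers the boundary condition from \<open>\<psi>\<close> to every function of the
  maximal domain once \<open>W(\<psi>, cnj \<psi>)\<close> is bounded away from zero, which contradicts nontriviality.\<close>
lemma limit_circle_wronskian_cnj_not_bounded_below:
  assumes \<psi>: "is_solution l q b z \<psi>" "L2_near_right b \<psi>"
    and w: "boundary_function_right l q b w"
    and W0: "wronskian_vanishes_right b (\<lambda>x. complex_of_real (w x)) \<psi>"
    and x0: "x0 \<in> einterval 0 b" and \<delta>: "\<delta> > 0"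
    and low: "\<And>y. y \<in> einterval 0 b \<Longrightarrow> x0 \<le> y \<Longrightarrow> cmod (wronskian \<psi> (\<lambda>t. cnj (\<psi> t)) y) \<ge> \<delta>"
  shows False
proof -
  define \<psi>' where "\<psi>' = (\<lambda>t. cnj (\<psi> t))"
  define w' where "w' = (\<lambda>x. complex_of_real (w x))"
  note sol' = is_solution_cnj[OF \<psi>(1), folded \<psi>'_def]
  obtain g where g: "has_second_derivative_ae w' g (einterval 0 b)"
    using w by (auto simp: boundary_function_right_def in_max_domain_right_def w'_def)
  obtain h where h: "in_max_domain_right l q b h" "\<not> wronskian_vanishes_right b w' h"
    using w by (auto simp: boundary_function_right_def w'_def)
  obtain d1 C1 where d1: "d1 \<in> einterval 0 b"
    and C1: "\<And>y. y \<in> einterval 0 b \<Longrightarrow> d1 \<le> y \<Longrightarrow> cmod (wronskian \<psi> h y) \<le> C1"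
    by (rule wronskian_bounded_near_right[OF \<psi> h(1)]) (rule that)
  obtain d2 C2 where d2: "d2 \<in> einterval 0 b"
    and C2: "\<And>y. y \<in> einterval 0 b \<Longrightarrow> d2 \<le> y \<Longrightarrow> cmod (wronskian \<psi>' h y) \<le> C2"
    by (rule wronskian_bounded_near_right[OF sol' L2_near_right_cnj[OF \<psi>(2), folded \<psi>'_def] h(1)]) (rule that)
  define d where "d = max x0 (max d1 d2)"
  have d: "d \<in> einterval 0 b" "x0 \<le> d" "d1 \<le> d" "d2 \<le> d" using d1 d2 x0 by (auto simp: d_def max_def)
  have bound: "cmod (wronskian w' h y) \<le> (C1 + C2) / \<delta> * cmod (wronskian w' \<psi> y)"
    if y: "y \<in> einterval 0 b" "d \<le> y" for y
  proof -
    \<comment> \<open>Since \<open>w\<close> is real, W(w, cnj \<psi>) is the conjugate of W(w,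
      \<psi>), so the boundary condition passes to the conjugate solution.\<close>
    have "cnj (dx w' y) = dx w' y"
      using has_second_derivative_ae_cnj(2)[OF g y(1)] by (simp add: w'_def)
    then have "wronskian w' \<psi>' y = cnj (wronskian w' \<psi> y)"
      using dx_cnj_solution[OF \<psi>(1) y(1)] by (simp add: wronskian_def w'_def \<psi>'_def)
    then have eqn: "cmod (wronskian w' \<psi>' y) = cmod (wronskian w' \<psi> y)" by simp
    have "wronskian w' h y * wronskian \<psi> \<psi>' y
        = wronskian w' \<psi>' y * wronskian \<psi> h y - wronskian w' \<psi> y * wronskian \<psi>' h y"
      by (simp add: wronskian_def algebra_simps)
    then have "cmod (wronskian w' h y) * cmod (wronskian \<psi> \<psi>' y)
        \<le> cmod (wronskian w' \<psi>' y) * cmod (wronskian \<psi> h y) + cmod (wronskian w' \<psi> y) * cmod (wronskian \<psi>' h y)"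
      by (metis norm_mult norm_triangle_ineq4)
    also have "\<dots> \<le> cmod (wronskian w' \<psi> y) * C1 + cmod (wronskian w' \<psi> y) * C2"
      unfolding eqn using C1[OF y(1)] C2[OF y(1)] y d by (intro add_mono mult_left_mono) auto
    finally have "cmod (wronskian w' h y) * cmod (wronskian \<psi> \<psi>' y) \<le> (C1 + C2) * cmod (wronskian w' \<psi> y)"
      by (simp add: algebra_simps)
    moreover have "cmod (wronskian w' h y) * \<delta> \<le> cmod (wronskian w' h y) * cmod (wronskian \<psi> \<psi>' y)"
      using low[OF y(1)] y(2) d(2) by (intro mult_left_mono) (auto simp: \<psi>'_def)
    ultimately show ?thesis using \<delta> by (simp add: field_simps)
  qed
  have db: "ereal d < b" using d(1) by (auto simp: einterval_def)
  have ev: "\<forall>\<^sub>F x in at_left b. real_of_ereal x \<in> einterval 0 b \<and> d \<le> real_of_ereal x"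
  proof -
    have "\<forall>\<^sub>F x in at_left b. ereal d < x \<and> x < b"
      using db by (auto simp: eventually_at_left[OF db])
    then show ?thesis
    proof eventually_elim
      case (elim x)
      then obtain r where r: "x = ereal r" by (cases x) auto
      show ?case using elim d(1) einterval_def[of 0 b] unfolding r by (auto simp: einterval_def)
    qed
  qed
  have "((\<lambda>x. wronskian w' h (real_of_ereal x)) \<longlongrightarrow> 0) (at_left b)"
  proof (rule Lim_null_comparison)
    show "\<forall>\<^sub>F x in at_left b. cmod (wronskian w' h (real_of_ereal x)) \<le>
            (C1 + C2) / \<delta> * cmod (wronskian w' \<psi> (real_of_ereal x))"
      using ev by eventually_elim (intro bound, auto)
    have "((\<lambda>x. wronskian w' \<psi> (real_of_ereal x)) \<longlongrightarrow> 0) (at_left b)"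
      using W0 by (simp add: wronskian_vanishes_right_def w'_def)
    from tendsto_mult_left[OF tendsto_norm[OF this], of "(C1 + C2) / \<delta>"]
    show "((\<lambda>x. (C1 + C2) / \<delta> * cmod (wronskian w' \<psi> (real_of_ereal x))) \<longlongrightarrow> 0) (at_left b)" by simp
  qed
  then show False using h(2) by (simp add: wronskian_vanishes_right_def)
qed

text \<open>By Lagrange's identity Im z * p has derivative - (Im z)^2 |\<psi>|^2. If it were
  negative at \<open>x\<close>, it would stay below that value up to \<open>b\<close>, and the
  boundary form would be bounded away from zero. At a limit circle endpoint the boundary condition
  excludes this. Otherwise \<phi> would be square integrable as well, and Weyl's theorem would make
  the endpoint limit circle after all.\<close>

lemma Im_mult_Im_weyl_solution_nonneg:
  assumes \<psi>: "is_solution l q b z \<psi>" and \<phi>: "is_solution l q b z \<phi>"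
    and W1: "\<And>x. x \<in> einterval 0 b \<Longrightarrow> wronskian \<psi> \<phi> x = 1"
    and dom: "in_domain_near_right l q b w \<psi>"
    and w: "limit_circle_right l q b \<Longrightarrow> boundary_function_right l q b w"
    and x: "x \<in> einterval 0 b"
  shows "Im z * Im (dx \<psi> x * cnj (\<psi> x)) \<ge> 0"
proof (rule ccontr)
  define p where "p = (\<lambda>x. Im (dx \<psi> x * cnj (\<psi> x)))"
  assume "\<not> ?thesis"
  then have neg: "Im z * p x < 0" by (simp add: p_def)
  have L2: "L2_near_right b \<psi>" using dom by (simp add: in_domain_near_right_def)
  have Wp: "wronskian \<psi> (\<lambda>t. cnj (\<psi> t)) y = - 2 * \<i> * of_real (p y)" if "y \<in> einterval 0 b" for y
    unfolding p_def by (rule wronskian_cnj_self[OF \<psi> that])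
  have mono: "Im z * p y \<le> Im z * p x" if y: "y \<in> einterval 0 b" "x \<le> y" for y
  proof -
    note sub = Icc_subset_einterval[OF x y(1)]
    have "(\<lambda>t. \<psi> t * cnj (\<psi> t)) = (\<lambda>t. of_real ((cmod (\<psi> t))\<^sup>2))"
      by (intro ext) (rule complex_norm_square[symmetric])
    moreover have "integral {x..y} (\<lambda>t. complex_of_real ((cmod (\<psi> t))\<^sup>2)) = of_real (integral {x..y} (\<lambda>t. (cmod (\<psi> t))\<^sup>2))"
      using integral_linear[OF _ bounded_linear_of_real, of "\<lambda>t. (cmod (\<psi> t))\<^sup>2" "{x..y}"] sub
      by (simp add: o_def integrable_continuous_real continuous_on_norm continuous_on_power
          solution_continuous_on[OF \<psi>])
    ultimately have "- 2 * \<i> * of_real (p y) - (- 2 * \<i> * of_real (p x)) =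
        (z - cnj z) * of_real (integral {x..y} (\<lambda>t. (cmod (\<psi> t))\<^sup>2))"
      using wronskian_solutions[OF \<psi> is_solution_cnj[OF \<psi>] x y] Wp[OF x] Wp[OF y(1)] by simp
    then have "p x - p y = Im z * integral {x..y} (\<lambda>t. (cmod (\<psi> t))\<^sup>2)"
      by (simp add: complex_eq_iff)
    then have "Im z * p x - Im z * p y = (Im z)\<^sup>2 * integral {x..y} (\<lambda>t. (cmod (\<psi> t))\<^sup>2)"
      by (simp add: power2_eq_square flip: right_diff_distrib)
    moreover have "integral {x..y} (\<lambda>t. (cmod (\<psi> t))\<^sup>2) \<ge> 0"
      using sub by (intro integral_nonneg integrable_continuous_real continuous_intros solution_continuous_on[OF \<psi>]) auto
    ultimately show ?thesis by (smt (verit) mult_nonneg_nonneg zero_le_power2)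
  qed
  define \<delta> where "\<delta> = 2 * \<bar>p x\<bar>"
  have \<delta>: "\<delta> > 0" using neg by (auto simp: \<delta>_def)
  have low: "\<delta> \<le> cmod (wronskian \<psi> (\<lambda>t. cnj (\<psi> t)) y)" if y: "y \<in> einterval 0 b" "x \<le> y" for y
  proof -
    have "\<bar>Im z\<bar> * \<bar>p x\<bar> \<le> \<bar>Im z\<bar> * \<bar>p y\<bar>"
      using mono[OF y] neg by (simp add: flip: abs_mult)
    then have "\<bar>p x\<bar> \<le> \<bar>p y\<bar>" using neg by (auto simp: mult_le_cancel_left)
    then show ?thesis unfolding Wp[OF y(1)] by (simp add: norm_mult \<delta>_def)
  qed
  show False
  proof (cases "limit_circle_right l q b")
    case True
    then show False
      using dom w limit_circle_wronskian_cnj_not_bounded_below[OF \<psi> L2 _ _ x \<delta> low]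
      by (auto simp: in_domain_near_right_def)
  next
    case False
    have "L2_near_right b \<phi>"
      by (rule L2_near_right_if_wronskian_cnj_bounded_below[OF \<psi> L2 \<phi> W1 x \<delta> low])
    from limit_circle_right_if_all_L2[OF \<psi> L2 \<phi> this W1 x] False show False by blast
  qed
qed

section \<open>Asymptotics along the imaginary axis\<close>

lemma norm_sin_le_exp_Im: "cmod (sin w) \<le> exp \<bar>Im w\<bar>"
proof -
  have "cmod (sin w) = cmod (exp (\<i> * w) - exp (- (\<i> * w))) / 2"
    by (simp add: sin_exp_eq norm_divide norm_mult)
  also have "\<dots> \<le> (cmod (exp (\<i> * w)) + cmod (exp (- (\<i> * w)))) / 2"
    by (intro divide_right_mono norm_triangle_ineq4) auto
  also have "\<dots> \<le> (exp \<bar>Im w\<bar> + exp \<bar>Im w\<bar>) / 2"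
    by (intro divide_right_mono add_mono) auto
  finally show ?thesis by simp
qed

lemma norm_cos_le_exp_Im: "cmod (cos w) \<le> exp \<bar>Im w\<bar>"
proof -
  have "cmod (cos w) = cmod (exp (\<i> * w) + exp (- (\<i> * w))) / 2"
    by (simp add: cos_exp_eq norm_divide)
  also have "\<dots> \<le> (cmod (exp (\<i> * w)) + cmod (exp (- (\<i> * w)))) / 2"
    by (intro divide_right_mono norm_triangle_ineq) auto
  also have "\<dots> \<le> (exp \<bar>Im w\<bar> + exp \<bar>Im w\<bar>) / 2"
    by (intro divide_right_mono add_mono) auto
  finally show ?thesis by simp
qed

section \<open>Comparison with the free equation on compact intervals\<close>

lemma potential_term_absolutely_integrable:
  assumes "admissible_potential l q" "0 < x"
  shows "potential_term l q absolutely_integrable_on {x..y}"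
proof -
  have "(\<lambda>t. l * (l + 1) / t\<^sup>2) absolutely_integrable_on {x..y}"
    using assms(2) by (intro absolutely_integrable_continuous_real continuous_intros) auto
  moreover have "q absolutely_integrable_on {x..y}"
    using assms by (simp add: admissible_potential_def)
  ultimately have "(\<lambda>t. l * (l + 1) / t\<^sup>2 + q t) absolutely_integrable_on {x..y}"
    by (rule set_integral_add(1))
  from absolutely_integrable_linear[OF this bounded_linear_of_real[where 'a = complex]]
  show ?thesis by (simp add: o_def potential_term_def[abs_def])
qed

text \<open>Lagrange's identity for \<open>u\<close> and the free solution sin (k (y - t)) / k,
  which vanishes at t = y with slope -1, so that the Wronskian there is - u y.\<close>

lemma variation_of_constants:
  assumes u: "is_solution l q b (k\<^sup>2) u" and k: "k \<noteq> 0"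
    and xy: "x \<in> einterval 0 b" "y \<in> einterval 0 b" "x \<le> y"
  shows "(\<lambda>t. potential_term l q t * u t * sin (k * of_real (y - t)) / k) absolutely_integrable_on {x..y}"
    and "u y = u x * cos (k * of_real (y - x)) + dx u x * sin (k * of_real (y - x)) / k
           + integral {x..y} (\<lambda>t. potential_term l q t * u t * sin (k * of_real (y - t)) / k)"
proof -
  define v where "v = (\<lambda>t. sin (k * of_real (y - t)) / k)"
  have dv: "(v has_vector_derivative - cos (k * of_real (y - t))) (at t within S)" for t S
  proof -
    have "((\<lambda>w. sin (k * (of_real y - w)) / k) has_field_derivative - cos (k * (of_real y - of_real t))) (at (of_real t))"
      using k by (auto intro!: derivative_eq_intros)
    from has_vector_derivative_real_field[OF this] show ?thesis by (simp add: v_def)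
  qed
  then have dx_v: "dx v t = - cos (k * of_real (y - t))" for t
    using vector_derivative_at by blast
  have ddv: "((\<lambda>t. - cos (k * of_real (y - t))) has_vector_derivative - k\<^sup>2 * v t) (at t within S)" for t S
  proof -
    have "((\<lambda>w. - cos (k * (of_real y - w))) has_field_derivative - k\<^sup>2 * (sin (k * (of_real y - of_real t)) / k)) (at (of_real t))"
      using k by (auto intro!: derivative_eq_intros simp: power2_eq_square)
    from has_vector_derivative_real_field[OF this] show ?thesis by (simp add: v_def)
  qed
  have v: "has_second_derivative_ae v (\<lambda>t. - k\<^sup>2 * v t) (einterval 0 b)"
    unfolding has_second_derivative_ae_def
  proof (intro conjI ballI impI)
    fix s t assume "s \<le> (t :: real)"
    show "(\<lambda>t. - k\<^sup>2 * v t) absolutely_integrable_on {s..t}"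
      unfolding v_def using k by (intro absolutely_integrable_continuous_real continuous_intros) auto
    show "integral {s..t} (\<lambda>t. - k\<^sup>2 * v t) = dx v t - dx v s"
      unfolding dx_v using \<open>s \<le> t\<close> ddv by (intro integral_unique fundamental_theorem_of_calculus)
  qed (use dv differentiableI_vector in blast)
  note W = wronskian_identity[OF u[unfolded is_solution_iff] v xy]
  have eq: "(\<lambda>t. u t * (- k\<^sup>2 * v t) - (potential_term l q t - k\<^sup>2) * u t * v t)
     = (\<lambda>t. - (potential_term l q t * u t * sin (k * of_real (y - t)) / k))"
    by (simp add: v_def algebra_simps fun_eq_iff)
  show "(\<lambda>t. potential_term l q t * u t * sin (k * of_real (y - t)) / k) absolutely_integrable_on {x..y}"
    using absolutely_integrable_linear[OF W(1)[unfolded eq] bounded_linear_minus[OF bounded_linear_ident]]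
    by (simp add: o_def)
  have "wronskian u v y = - u y" unfolding wronskian_def dx_v by (simp add: v_def)
  moreover have "wronskian u v x = - (u x * cos (k * of_real (y - x))) - dx u x * sin (k * of_real (y - x)) / k"
    unfolding wronskian_def dx_v by (simp add: v_def)
  moreover have "wronskian u v y - wronskian u v x
      = - integral {x..y} (\<lambda>t. potential_term l q t * u t * sin (k * of_real (y - t)) / k)"
    using W(2) unfolding eq integral_neg .
  ultimately show "u y = u x * cos (k * of_real (y - x)) + dx u x * sin (k * of_real (y - x)) / k
           + integral {x..y} (\<lambda>t. potential_term l q t * u t * sin (k * of_real (y - t)) / k)"
    by algebra
qed

text \<open>The weight exp (- \<kappa> (s - x)) in \<open>N\<close> cancels the growth of the sine
  kernel. What remains has mass at most Q / |k| <= 1/2, so N <= 2 K.\<close>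

lemma free_solution_error_bound:
  assumes u: "is_solution l q b (k\<^sup>2) u" and q: "admissible_potential l q"
    and xy: "x \<in> einterval 0 b" "y \<in> einterval 0 b" "x \<le> y" and x0: "0 < x"
    and Q: "integral {x..y} (\<lambda>t. cmod (potential_term l q t)) \<le> Q" and k: "2 * Q \<le> cmod k" "k \<noteq> 0"
  shows "cmod (u y - u x * cos (k * of_real (y - x)) - dx u x * sin (k * of_real (y - x)) / k)
           \<le> 2 * Q / cmod k * (cmod (u x) + cmod (dx u x) / cmod k) * exp (\<bar>Im k\<bar> * (y - x))"
proof -
  define \<kappa> where "\<kappa> = \<bar>Im k\<bar>"
  define K where "K = cmod (u x) + cmod (dx u x) / cmod k"
  define N where "N = (\<lambda>s. exp (- \<kappa> * (s - x)) * cmod (u s))"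
  define V where "V = (\<lambda>t. cmod (potential_term l q t))"
  define \<rho> where "\<rho> = (\<lambda>t. V t / cmod k)"
  have kp: "cmod k > 0" using k by simp
  have V: "V absolutely_integrable_on {x..s}" for s
    unfolding V_def using absolutely_integrable_norm[OF potential_term_absolutely_integrable[OF q x0]]
    by (simp add: o_def)
  have \<rho>: "\<rho> absolutely_integrable_on {x..s}" for s unfolding \<rho>_def using V by simp
  have trig: "cmod (sin (k * of_real r)) \<le> exp (\<kappa> * r)" "cmod (cos (k * of_real r)) \<le> exp (\<kappa> * r)"
    if "r \<ge> 0" for r
    using norm_sin_le_exp_Im[of "k * of_real r"] norm_cos_le_exp_Im[of "k * of_real r"] that
    by (simp_all add: abs_mult \<kappa>_def)
  define R where "R s = integral {x..s} (\<lambda>t. potential_term l q t * u t * sin (k * of_real (s - t)) / k)" for s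
  have contN: "continuous_on {x..s} N" if "s \<in> einterval 0 b" for s
    unfolding N_def
    by (intro continuous_intros solution_continuous_on[OF u] Icc_subset_einterval[OF xy(1) that])
  have \<rho>N: "(\<lambda>t. \<rho> t * N t) integrable_on {x..s}" if "s \<in> einterval 0 b" for s
    by (intro set_lebesgue_integral_eq_integral(1) absolutely_integrable_mult_continuous \<rho> contN that)
  have R: "cmod (R s) \<le> exp (\<kappa> * (s - x)) * integral {x..s} (\<lambda>t. \<rho> t * N t)"
    if s: "s \<in> einterval 0 b" "x \<le> s" for s
  proof -
    have "cmod (R s) \<le> integral {x..s} (\<lambda>t. exp (\<kappa> * (s - x)) * (\<rho> t * N t))"
      unfolding R_def
    proof (rule integral_norm_bound_integral)
      show "(\<lambda>t. potential_term l q t * u t * sin (k * of_real (s - t)) / k) integrable_on {x..s}"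
        using variation_of_constants(1)[OF u k(2) xy(1) s] set_lebesgue_integral_eq_integral(1) by blast
      show "(\<lambda>t. exp (\<kappa> * (s - x)) * (\<rho> t * N t)) integrable_on {x..s}"
        by (intro integrable_on_mult_right \<rho>N s)
      fix t assume t: "t \<in> {x..s}"
      have "cmod (potential_term l q t * u t * sin (k * of_real (s - t)) / k)
          = \<rho> t * cmod (u t) * cmod (sin (k * of_real (s - t)))"
        by (simp add: norm_mult norm_divide \<rho>_def V_def)
      also have "\<dots> \<le> \<rho> t * cmod (u t) * exp (\<kappa> * (s - t))"
        using t by (intro mult_left_mono trig) (auto simp: \<rho>_def V_def)
      also have "exp (\<kappa> * (s - t)) = exp (\<kappa> * (s - x)) * exp (- \<kappa> * (t - x))"
        by (simp add: algebra_simps flip: exp_add)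
      finally show "cmod (potential_term l q t * u t * sin (k * of_real (s - t)) / k)
          \<le> exp (\<kappa> * (s - x)) * (\<rho> t * N t)" by (simp add: N_def mult_ac)
    qed
    then show ?thesis by simp
  qed
  have small: "integral {x..y} \<rho> \<le> Q / cmod k"
    unfolding \<rho>_def using Q kp by (simp add: V_def divide_right_mono)
  have N_le: "N t \<le> 2 * K" if t: "t \<in> {x..y}" for t
  proof (rule bounded_by_small_kernel[OF xy(3) contN[OF xy(2)] \<rho> _ _ _ _ t])
    show "integral {x..y} \<rho> \<le> 1/2"
    proof -
      have "Q / cmod k \<le> 1/2" using k kp by (simp add: field_simps)
      with small show ?thesis by linarith
    qed
    fix s assume s: "s \<in> {x..y}"
    then have sI: "s \<in> einterval 0 b" "x \<le> s" using Icc_subset_einterval[OF xy(1,2)] by auto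
    have "cmod (u s) \<le> cmod (u x) * exp (\<kappa> * (s - x)) + cmod (dx u x) * exp (\<kappa> * (s - x)) / cmod k
        + exp (\<kappa> * (s - x)) * integral {x..s} (\<lambda>t. \<rho> t * N t)"
      unfolding variation_of_constants(2)[OF u k(2) xy(1) sI, folded R_def]
      using trig[of "s - x"] sI(2) kp R[OF sI]
      by (intro norm_triangle_mono) (auto simp: norm_mult norm_divide intro!: mult_left_mono divide_right_mono)
    also have "\<dots> = exp (\<kappa> * (s - x)) * (K + integral {x..s} (\<lambda>t. \<rho> t * N t))"
      by (simp add: K_def algebra_simps)
    finally have "exp (- \<kappa> * (s - x)) * cmod (u s) \<le>
        exp (- \<kappa> * (s - x)) * (exp (\<kappa> * (s - x)) * (K + integral {x..s} (\<lambda>t. \<rho> t * N t)))"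
      by (intro mult_left_mono) auto
    also have "\<dots> = K + integral {x..s} (\<lambda>t. \<rho> t * N t)"
      by (simp add: mult.assoc[symmetric] flip: exp_add)
    finally show "N s \<le> K + integral {x..s} (\<lambda>t. \<rho> t * N t)" by (simp add: N_def)
  qed (auto simp: K_def \<rho>_def V_def)
  \<comment> \<open>Inserting the crude bound into the integral once more gains the factor Q / |k|,
    which makes the error small for large \<open>k\<close>.\<close>
  have "integral {x..y} (\<lambda>t. \<rho> t * N t) \<le> integral {x..y} (\<lambda>t. \<rho> t * (2 * K))"
    by (intro integral_le \<rho>N xy integrable_on_mult_left set_lebesgue_integral_eq_integral(1) \<rho> mult_left_mono N_le)
       (auto simp: \<rho>_def V_def)
  also have "\<dots> = integral {x..y} \<rho> * (2 * K)" by simp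
  also have "\<dots> \<le> Q / cmod k * (2 * K)" using small by (intro mult_right_mono) (auto simp: K_def)
  finally have "exp (\<kappa> * (y - x)) * integral {x..y} (\<lambda>t. \<rho> t * N t) \<le> exp (\<kappa> * (y - x)) * (Q / cmod k * (2 * K))"
    by (intro mult_left_mono) auto
  with R[OF xy(2,3)] have "cmod (R y) \<le> 2 * Q / cmod k * K * exp (\<kappa> * (y - x))"
    by (simp add: mult_ac)
  moreover have "u y - u x * cos (k * of_real (y - x)) - dx u x * sin (k * of_real (y - x)) / k = R y"
    using variation_of_constants(2)[OF u k(2) xy, folded R_def] by simp
  ultimately show ?thesis by (simp add: K_def \<kappa>_def)
qed

lemma csqrt_imaginary:
  assumes "\<sigma> \<in> {1, - 1}" "t > 0"
  shows "csqrt (\<i> * of_real (\<sigma> * t)) = of_real (sqrt (t / 2)) * (1 + \<i> * of_real \<sigma>)"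
proof (rule csqrt_unique)
  have "(of_real (sqrt (t / 2)))\<^sup>2 = complex_of_real (t / 2)"
    using assms by (simp flip: of_real_power)
  then show "(of_real (sqrt (t / 2)) * (1 + \<i> * of_real \<sigma>))\<^sup>2 = \<i> * of_real (\<sigma> * t)"
    using assms by (auto simp: power_mult_distrib power2_sum)
qed (use assms in auto)

text \<open>With \<open>\<nu> = u'(x) / (k u(x)) + i\<sigma>\<close>, the ratio \<open>u(y) / u(x)\<close> differs from its free value
  \<open>exp (- i\<sigma>k(y - x))\<close> by a multiple of \<open>\<nu>\<close>, so closeness of the ratio forces \<open>\<nu>\<close> to be small.\<close>
lemma Im_log_derivative_le:
  assumes u: "is_solution l q b (k\<^sup>2) u" and q: "admissible_potential l q"
    and xy: "x \<in> einterval 0 b" "y \<in> einterval 0 b" "x \<le> y" and x0: "0 < x"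
    and Q: "integral {x..y} (\<lambda>t. cmod (potential_term l q t)) \<le> Q"
    and \<sigma>: "\<sigma> \<in> {1, - 1}" and \<kappa>: "\<kappa> > 0" and k: "k = of_real \<kappa> * (1 + \<i> * of_real \<sigma>)"
    and large: "160 * Q \<le> \<kappa>" "exp (- 2 * \<kappa> * (y - x)) \<le> 1/5"
    and nz: "u x \<noteq> 0"
    and ratio: "cmod (u y * exp (\<i> * of_real \<sigma> * k * of_real (y - x)) / u x - 1) \<le> 1/40"
  shows "\<sigma> * Im (dx u x / u x) \<le> - \<kappa> / 2"
proof -
  define w where "w = k * of_real (y - x)"
  \<comment> \<open>Multiplication by \<open>c\<close> removes the exponential growth: cos w and sin
    w turn into (1 + c^2) / 2 and i\<sigma> (1 - c^2) / 2, where |c^2| <= 1/5 by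
    \<open>large\<close>.\<close>
  define c where "c = exp (\<i> * of_real \<sigma> * w)"
  define \<mu> where "\<mu> = dx u x / (u x * k)"
  define \<nu> where "\<nu> = \<mu> + \<i> * of_real \<sigma>"
  define E where "E = u y - u x * cos w - dx u x * sin w / k"
  have \<sigma>2: "\<sigma> * \<sigma> = 1" "\<bar>\<sigma>\<bar> = 1" using \<sigma> by auto
  have knz: "k \<noteq> 0" using \<kappa> by (auto simp: k complex_eq_iff)
  have Imk: "\<bar>Im k\<bar> = \<kappa>" using \<kappa> \<sigma>2 by (simp add: k abs_mult)
  have kle: "\<kappa> \<le> cmod k" using abs_Im_le_cmod[of k] Imk by simp
  \<comment> \<open>The exact value is sqrt 2 * \<kappa>; 3/2 is a convenient rational
    bound.\<close>
  have kge: "cmod k \<le> 3/2 * \<kappa>"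
  proof (rule power2_le_imp_le)
    have "(cmod k)\<^sup>2 = 2 * \<kappa>\<^sup>2" unfolding cmod_power2 k using \<sigma> by auto
    then show "(cmod k)\<^sup>2 \<le> (3/2 * \<kappa>)\<^sup>2" by (simp add: power2_eq_square)
  qed (use \<kappa> in auto)
  have "integral {x..y} (\<lambda>t. cmod (potential_term l q t)) \<ge> 0"
    by (intro integral_nonneg set_lebesgue_integral_eq_integral(1)
         absolutely_integrable_norm[OF potential_term_absolutely_integrable[OF q x0], unfolded o_def]) auto
  then have Qp: "Q \<ge> 0" using Q by linarith
  have cn: "cmod c = exp (- \<kappa> * (y - x))"
  proof -
    have "Re (\<i> * of_real \<sigma> * w) = - \<kappa> * (y - x)" unfolding w_def k using \<sigma> by (auto simp: algebra_simps)
    then show ?thesis by (simp add: c_def)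
  qed
  have cnz: "c \<noteq> 0" by (simp add: c_def)
  have trig: "cos w * c = (1 + c\<^sup>2) / 2" "sin w * c = \<i> * of_real \<sigma> * (1 - c\<^sup>2) / 2"
  proof -
    have e: "exp (\<i> * w) * exp (\<i> * w) = (exp (\<i> * w))\<^sup>2" "exp (- (\<i> * w)) * exp (- (\<i> * w)) = (exp (- (\<i> * w)))\<^sup>2"
      "exp (\<i> * w) * exp (- (\<i> * w)) = 1" "exp (- (\<i> * w)) * exp (\<i> * w) = 1"
      by (simp_all add: power2_eq_square exp_minus)
    show "cos w * c = (1 + c\<^sup>2) / 2" "sin w * c = \<i> * of_real \<sigma> * (1 - c\<^sup>2) / 2"
      using \<sigma> e unfolding c_def cos_exp_eq sin_exp_eq by (auto simp: field_simps)
  qed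
  have "cmod E \<le> 2 * Q / cmod k * (cmod (u x) + cmod (dx u x) / cmod k) * exp (\<kappa> * (y - x))"
    unfolding E_def w_def Imk[symmetric] using large kle Qp knz
    by (intro free_solution_error_bound[OF u q xy x0 Q]) auto
  also have "cmod (u x) + cmod (dx u x) / cmod k = cmod (u x) * (1 + cmod \<mu>)"
    using nz by (simp add: \<mu>_def norm_divide norm_mult field_simps)
  finally have "cmod E * cmod c \<le>
      2 * Q / cmod k * (cmod (u x) * (1 + cmod \<mu>)) * exp (\<kappa> * (y - x)) * cmod c"
    by (intro mult_right_mono) auto
  also have "\<dots> = 2 * Q / cmod k * (1 + cmod \<mu>) * cmod (u x)"
    unfolding cn by (simp add: mult_ac flip: exp_add)
  finally have Ec: "cmod (E * c / u x) \<le> 2 * Q / cmod k * (1 + cmod \<mu>)"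
    using nz by (simp add: norm_mult norm_divide field_simps)
  \<comment> \<open>The constant 160 in \<open>large\<close> is 2 * 80. The error is bounded through
    \<mu>, hence through \<nu>, and 1/80 is small enough for this term to be absorbed on the
    left.\<close>
  also have "\<dots> \<le> 1/80 * (1 + cmod \<mu>)"
  proof (intro mult_right_mono)
    have "160 * Q \<le> cmod k" "cmod k > 0" using large(1) kle \<kappa> by auto
    then show "2 * Q / cmod k \<le> 1/80" by (simp add: divide_le_eq)
  qed auto
  also have "cmod \<mu> \<le> cmod \<nu> + 1"
    using norm_triangle_ineq4[of \<nu> "\<i> * of_real \<sigma>"] \<sigma>2 by (simp add: \<nu>_def norm_mult)
  finally have Ec: "cmod (E * c / u x) \<le> 1/80 * (2 + cmod \<nu>)" by simp
  have "u y * c / u x = cos w * c + \<mu> * (sin w * c) + E * c / u x"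
    using nz knz by (simp add: E_def \<mu>_def field_simps)
  also have "cos w * c + \<mu> * (sin w * c) = 1 + \<i> * of_real \<sigma> * \<nu> * (1 - c\<^sup>2) / 2"
  proof -
    have s: "complex_of_real \<sigma> * complex_of_real \<sigma> = 1" using \<sigma>2(1) by (metis of_real_1 of_real_mult)
    have m: "\<mu> * (\<i> * of_real \<sigma>) = 1 + \<i> * of_real \<sigma> * \<nu>"
      unfolding \<nu>_def by (simp add: distrib_left mult_ac s)
    have "\<mu> * (sin w * c) = (1 + \<i> * of_real \<sigma> * \<nu>) * ((1 - c\<^sup>2) / 2)"
      unfolding trig m[symmetric] by simp
    with trig(1) show ?thesis by (simp only:) (simp add: field_simps)
  qed
  finally have L: "\<i> * of_real \<sigma> * \<nu> * (1 - c\<^sup>2) / 2 = (u y * c / u x - 1) - E * c / u x" by simp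
  have "cmod (u y * c / u x - 1) \<le> 1/40" using ratio by (simp add: c_def w_def mult_ac)
  moreover have "cmod (\<i> * of_real \<sigma> * \<nu> * (1 - c\<^sup>2) / 2) \<le> cmod (u y * c / u x - 1) + cmod (E * c / u x)"
    unfolding L by (rule norm_triangle_ineq4)
  ultimately have "cmod (\<i> * of_real \<sigma> * \<nu> * (1 - c\<^sup>2) / 2) \<le> 1/40 + 1/80 * (2 + cmod \<nu>)"
    using Ec by linarith
  moreover have "cmod (\<i> * of_real \<sigma> * \<nu> * (1 - c\<^sup>2) / 2) = cmod \<nu> * cmod (1 - c\<^sup>2) / 2"
    using \<sigma>2 by (simp add: norm_mult norm_divide)
  moreover have "cmod \<nu> * cmod (1 - c\<^sup>2) \<ge> cmod \<nu> * (4/5)"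
  proof (intro mult_left_mono)
    have "cmod (c\<^sup>2) \<le> 1/5" using large(2) unfolding norm_power cn by (simp flip: exp_of_nat_mult add: algebra_simps)
    then show "4/5 \<le> cmod (1 - c\<^sup>2)" using norm_triangle_ineq2[of 1 "c\<^sup>2"] by simp
  qed auto
  \<comment> \<open>With n = |\<nu>| the estimates combine to (2/5) n <= 1/20 + n/80.\<close>
  moreover have "n \<le> 1/4" if "a \<le> 1/40 + 1/80 * (2 + n)" "a = X / 2" "n * (4/5) \<le> X" for a n X :: real
    using that by (simp add: field_simps)
  ultimately have \<nu>_le: "cmod \<nu> \<le> 1/4" by blast
  have "dx u x / u x = k * \<mu>" using knz nz by (simp add: \<mu>_def)
  also have "\<dots> = - \<i> * of_real \<sigma> * k + k * \<nu>" by (simp add: \<nu>_def algebra_simps)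
  finally have du: "dx u x / u x = - \<i> * of_real \<sigma> * k + k * \<nu>" .
  have "\<sigma> * Im (dx u x / u x) = \<sigma> * (- \<sigma> * Re k) + \<sigma> * Im (k * \<nu>)"
    unfolding du by (simp add: algebra_simps)
  also have "\<sigma> * (- \<sigma> * Re k) = - \<kappa>" using \<sigma>2 by (simp add: k mult.assoc[symmetric])
  also have "\<sigma> * Im (k * \<nu>) \<le> cmod (k * \<nu>)"
    using abs_Im_le_cmod[of "k * \<nu>"] \<sigma> by auto
  \<comment> \<open>The correction is at most 3/8 of \<kappa>, so more than half of the main term -
    \<kappa> survives.\<close>
  also have "cmod (k * \<nu>) \<le> (3/2 * \<kappa>) * (1/4)" unfolding norm_mult using kge \<nu>_le \<kappa> by (intro mult_mono) auto
  finally show ?thesis using \<kappa> by simp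
qed

text \<open>The logarithmic derivatives of \<phi> and \<psi> enter the reciprocal Green function
  with opposite signs, so their imaginary parts reinforce each other and the one of \<phi> alone
  bounds it from below.\<close>

lemma green_function_bound:
  assumes W: "wronskian \<psi> \<phi> x = 1" and \<sigma>: "\<sigma> \<in> {1, - 1 :: real}" and \<kappa>: "\<kappa> > 0"
    and \<psi>: "\<sigma> * Im (dx \<psi> x * cnj (\<psi> x)) \<ge> 0"
    and \<phi>: "\<phi> x \<noteq> 0" "\<sigma> * Im (dx \<phi> x / \<phi> x) \<le> - \<kappa> / 2"
  shows "cmod (\<phi> x * \<psi> x) \<le> 2 / \<kappa>"
proof (cases "\<psi> x = 0")
  case False
  have eq: "1 / (\<phi> x * \<psi> x) = dx \<phi> x / \<phi> x - dx \<psi> x / \<psi> x"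
    using W False \<phi>(1) by (simp add: wronskian_def field_simps)
  have "\<sigma> * Im (1 / (\<phi> x * \<psi> x)) = \<sigma> * Im (dx \<phi> x / \<phi> x) - \<sigma> * Im (dx \<psi> x / \<psi> x)"
    unfolding eq by (simp add: right_diff_distrib)
  also have "\<sigma> * Im (dx \<psi> x / \<psi> x) = (\<sigma> * Im (dx \<psi> x * cnj (\<psi> x))) / (cmod (\<psi> x))\<^sup>2"
    by (subst complex_div_cnj) simp
  finally have "\<sigma> * Im (1 / (\<phi> x * \<psi> x)) \<le> - \<kappa> / 2"
    using \<phi>(2) \<psi> by (smt (verit) divide_nonneg_nonneg zero_le_power2)
  then have "\<kappa> / 2 \<le> cmod (1 / (\<phi> x * \<psi> x))"
    using abs_Im_le_cmod[of "1 / (\<phi> x * \<psi> x)"] \<sigma> by auto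
  then show ?thesis using \<kappa> False \<phi>(1) by (simp add: norm_divide field_simps norm_mult)
qed (use \<kappa> in auto)

section \<open>The two halves of the imaginary axis\<close>

definition ray :: "real \<Rightarrow> real \<Rightarrow> complex" where
  "ray \<sigma> t = \<i> * of_real (\<sigma> * t)"

text \<open>The principal root on \<open>ray \<sigma> t\<close> for t > 0 in Cartesian form; its
  real part sqrt (t / 2) is the \<kappa> of the preceding estimates.\<close>

definition ray_sqrt :: "real \<Rightarrow> real \<Rightarrow> complex" where
  "ray_sqrt \<sigma> t = of_real (sqrt (t / 2)) * (1 + \<i> * of_real \<sigma>)"

text \<open>The exponentially growing half of the asymptotic formula: sin W = (i\<sigma> / 2) (exp
  (- i\<sigma>W) - exp (i\<sigma>W)), and on the ray the first exponential dominates.\<close>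

definition leading_term :: "real \<Rightarrow> real \<Rightarrow> real \<Rightarrow> real \<Rightarrow> complex" where
  "leading_term l \<sigma> t x = ray \<sigma> t powr (- complex_of_real ((l + 1) / 2)) * (\<i> * of_real \<sigma> / 2) *
     exp (- \<i> * of_real \<sigma> * (ray_sqrt \<sigma> t * of_real x - of_real (l * pi / 2)))"

context
  fixes \<sigma> :: real
  assumes \<sigma>: "\<sigma> \<in> {1, - 1}"
begin

lemma csqrt_ray: "t > 0 \<Longrightarrow> csqrt (ray \<sigma> t) = ray_sqrt \<sigma> t"
  using csqrt_imaginary[OF \<sigma>] by (simp add: ray_def ray_sqrt_def)

lemma ray_sqrt_power2: "t > 0 \<Longrightarrow> (ray_sqrt \<sigma> t)\<^sup>2 = ray \<sigma> t"
  using csqrt_ray power2_csqrt by metis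

lemma abs_Im_csqrt_ray: "t > 0 \<Longrightarrow> \<bar>Im (csqrt (ray \<sigma> t))\<bar> = sqrt (t / 2)"
  using \<sigma> by (auto simp: csqrt_ray ray_sqrt_def)

lemma cmod_ray: "cmod (ray \<sigma> t) = \<bar>t\<bar>"
  using \<sigma> by (auto simp: ray_def norm_mult)

lemma filterlim_ray: "filterlim (ray \<sigma>) at_infinity at_top"
  unfolding filterlim_at_infinity_conv_norm_at_top cmod_ray by (rule filterlim_abs_real)

lemma leading_term_nonzero: "t > 0 \<Longrightarrow> leading_term l \<sigma> t x \<noteq> 0"
  using \<sigma> by (auto simp: leading_term_def ray_def)

lemma leading_term_shift:
  "leading_term l \<sigma> t x = leading_term l \<sigma> t y * exp (\<i> * of_real \<sigma> * ray_sqrt \<sigma> t * of_real (y - x))"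
  unfolding leading_term_def by (simp add: algebra_simps flip: exp_add)

lemma cmod_leading_term_le:
  assumes "t \<ge> 1" "l \<ge> - 1/2"
  shows "cmod (leading_term l \<sigma> t x) \<le> exp (sqrt (t / 2) * x) / 2"
proof -
  have Re_eq: "Re (- \<i> * of_real \<sigma> * (ray_sqrt \<sigma> t * of_real x - of_real (l * pi / 2))) = sqrt (t / 2) * x"
    unfolding ray_sqrt_def using \<sigma> by auto
  have "cmod (leading_term l \<sigma> t x) = t powr (- ((l + 1) / 2)) * (exp (sqrt (t / 2) * x) / 2)"
    unfolding leading_term_def norm_mult norm_exp_eq_Re Re_eq using assms \<sigma>
    by (auto simp: norm_powr_real_powr' cmod_ray norm_divide norm_mult)
  moreover have "t powr (- ((l + 1) / 2)) \<le> 1"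
    using assms powr_mono[of "- ((l + 1) / 2)" 0 t] by simp
  ultimately show ?thesis by (simp add: mult_left_le_one_le)
qed

text \<open>With e = exp (i\<sigma>W) the quotient equals 1 - e^2 - 2 i\<sigma> r e. The modulus of
  \<open>e\<close> is the reciprocal of the weight in the little-o condition on \<open>r\<close>, so
  both corrections vanish.\<close>

lemma phi_over_leading_term_tendsto:
  assumes \<phi>: "phi_asymptotics l b \<phi>" and x: "x \<in> einterval 0 b"
  shows "((\<lambda>t. \<phi> (ray \<sigma> t) x / leading_term l \<sigma> t x) \<longlongrightarrow> 1) at_top"
proof -
  have x0: "x > 0" using x by (simp add: einterval_def)
  obtain r where r: "r \<in> o[at_infinity](\<lambda>z. complex_of_real (exp (x * \<bar>Im (csqrt z)\<bar>)))"
    and eq: "\<forall>\<^sub>F z in at_infinity. \<phi> z x = z powr (- complex_of_real ((l + 1) / 2)) *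
                     (sin (csqrt z * complex_of_real x - complex_of_real (l * pi / 2)) + r z)"
    using \<phi> x by (auto simp: phi_asymptotics_def)
  define W where "W t = ray_sqrt \<sigma> t * of_real x - of_real (l * pi / 2)" for t
  define e where "e t = exp (\<i> * of_real \<sigma> * W t)" for t
  have Re_W: "Re (\<i> * of_real \<sigma> * W t) = - (sqrt (t / 2) * x)" for t
    unfolding W_def ray_sqrt_def using \<sigma> by auto
  have cmod_e: "cmod (e t) = exp (- (sqrt (t / 2) * x))" for t
    unfolding e_def norm_exp_eq_Re Re_W ..
  have "((\<lambda>z. r z / complex_of_real (exp (x * \<bar>Im (csqrt z)\<bar>))) \<longlongrightarrow> 0) at_infinity"
    by (rule smalloD_tendsto[OF r])
  then have "((\<lambda>t. r (ray \<sigma> t) / complex_of_real (exp (x * \<bar>Im (csqrt (ray \<sigma> t))\<bar>))) \<longlongrightarrow> 0) at_top"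
    by (rule filterlim_compose[OF _ filterlim_ray])
  from tendsto_norm_zero[OF this]
  have r0: "((\<lambda>t. cmod (r (ray \<sigma> t)) / exp (x * \<bar>Im (csqrt (ray \<sigma> t))\<bar>)) \<longlongrightarrow> 0) at_top"
    unfolding norm_divide norm_of_real abs_exp_cancel .
  have re0: "((\<lambda>t. r (ray \<sigma> t) * e t) \<longlongrightarrow> 0) at_top"
  proof (rule tendsto_norm_zero_cancel, rule Lim_transform_eventually[OF r0])
    show "\<forall>\<^sub>F t in at_top. cmod (r (ray \<sigma> t)) / exp (x * \<bar>Im (csqrt (ray \<sigma> t))\<bar>) = cmod (r (ray \<sigma> t) * e t)"
      using eventually_gt_at_top[of 0]
    proof eventually_elim
      case (elim t)
      show ?case unfolding abs_Im_csqrt_ray[OF elim] norm_mult cmod_e by (simp add: exp_minus field_simps)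
    qed
  qed
  have e0: "(e \<longlongrightarrow> 0) at_top"
  proof (rule tendsto_norm_zero_cancel)
    show "((\<lambda>t. cmod (e t)) \<longlongrightarrow> 0) at_top" unfolding cmod_e using x0 by real_asymp
  qed
  have "((\<lambda>t. 1 - (e t)\<^sup>2 - 2 * \<i> * of_real \<sigma> * (r (ray \<sigma> t) * e t)) \<longlongrightarrow> 1 - 0\<^sup>2 - 2 * \<i> * of_real \<sigma> * 0) at_top"
    by (intro tendsto_intros e0 re0)
  then have lim: "((\<lambda>t. 1 - (e t)\<^sup>2 - 2 * \<i> * of_real \<sigma> * (r (ray \<sigma> t) * e t)) \<longlongrightarrow> 1) at_top" by simp
  show ?thesis
  proof (rule Lim_transform_eventually[OF lim])
    have "\<forall>\<^sub>F t in at_top. \<phi> (ray \<sigma> t) x = ray \<sigma> t powr (- complex_of_real ((l + 1) / 2)) *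
        (sin (csqrt (ray \<sigma> t) * complex_of_real x - complex_of_real (l * pi / 2)) + r (ray \<sigma> t))"
      using eq filterlim_ray by (rule eventually_compose_filterlim)
    then show "\<forall>\<^sub>F t in at_top. 1 - (e t)\<^sup>2 - 2 * \<i> * of_real \<sigma> * (r (ray \<sigma> t) * e t)
        = \<phi> (ray \<sigma> t) x / leading_term l \<sigma> t x"
      using eventually_gt_at_top[of 0]
    proof eventually_elim
      case (elim t)
      define P where "P = ray \<sigma> t powr (- complex_of_real ((l + 1) / 2))"
      have P: "P \<noteq> 0" using elim \<sigma> by (auto simp: P_def ray_def)
      have lt: "leading_term l \<sigma> t x = P * (\<i> * of_real \<sigma> / 2) * inverse (e t)"
        unfolding leading_term_def P_def e_def W_def by (simp add: exp_minus)
      have \<phi>t: "\<phi> (ray \<sigma> t) x = P * (sin (W t) + r (ray \<sigma> t))"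
        using elim by (simp add: csqrt_ray W_def P_def)
      have e_nz: "e t \<noteq> 0" by (simp add: e_def)
      have sin: "sin (W t) = (\<i> * of_real \<sigma> / 2) * (inverse (e t) - e t)"
        unfolding sin_exp_eq e_def using \<sigma> by (auto simp: exp_minus field_simps)
      show ?case unfolding lt \<phi>t sin using \<sigma> P e_nz by (auto simp: field_simps power2_eq_square)
    qed
  qed
qed

lemma phi_ray_nonzero:
  assumes "phi_asymptotics l b \<phi>" "x \<in> einterval 0 b"
  shows "\<forall>\<^sub>F t in at_top. \<phi> (ray \<sigma> t) x \<noteq> 0"
proof -
  have "\<forall>\<^sub>F t in at_top. \<phi> (ray \<sigma> t) x / leading_term l \<sigma> t x \<noteq> 0"
    using phi_over_leading_term_tendsto[OF assms] by (rule tendsto_imp_eventually_ne) simp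
  then show ?thesis by eventually_elim auto
qed

text \<open>Serves two purposes: with one \<phi> and two points it gives the ratio from which the
  logarithmic derivative is recovered; with one point and two potentials it says that the two
  solutions are asymptotically equal.\<close>

lemma phi_ray_quotient_tendsto:
  assumes \<phi>: "phi_asymptotics l b \<phi>" "phi_asymptotics l b \<phi>'"
    and xy: "x \<in> einterval 0 b" "y \<in> einterval 0 b"
  shows "((\<lambda>t. \<phi> (ray \<sigma> t) y * exp (\<i> * of_real \<sigma> * ray_sqrt \<sigma> t * of_real (y - x)) / \<phi>' (ray \<sigma> t) x) \<longlongrightarrow> 1) at_top"
proof -
  have "((\<lambda>t. (\<phi> (ray \<sigma> t) y / leading_term l \<sigma> t y) / (\<phi>' (ray \<sigma> t) x / leading_term l \<sigma> t x)) \<longlongrightarrow> 1 / 1) at_top"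
    using phi_over_leading_term_tendsto[OF \<phi>(1) xy(2)] phi_over_leading_term_tendsto[OF \<phi>(2) xy(1)]
    by (intro tendsto_divide) auto
  then have lim: "((\<lambda>t. (\<phi> (ray \<sigma> t) y / leading_term l \<sigma> t y) / (\<phi>' (ray \<sigma> t) x / leading_term l \<sigma> t x)) \<longlongrightarrow> 1) at_top"
    by simp
  show ?thesis
  proof (rule Lim_transform_eventually[OF lim])
    show "\<forall>\<^sub>F t in at_top. (\<phi> (ray \<sigma> t) y / leading_term l \<sigma> t y) / (\<phi>' (ray \<sigma> t) x / leading_term l \<sigma> t x)
      = \<phi> (ray \<sigma> t) y * exp (\<i> * of_real \<sigma> * ray_sqrt \<sigma> t * of_real (y - x)) / \<phi>' (ray \<sigma> t) x"
      using eventually_gt_at_top[of 0]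
    proof eventually_elim
      case (elim t)
      then show ?case
        using leading_term_nonzero[of t l y]
        unfolding leading_term_shift[of l t x y] by (simp add: field_simps)
    qed
  qed
qed

lemma cmod_phi_ray_le:
  assumes "phi_asymptotics l b \<phi>" "x \<in> einterval 0 b" "l \<ge> - 1/2"
  shows "\<forall>\<^sub>F t in at_top. cmod (\<phi> (ray \<sigma> t) x) \<le> exp (sqrt (t / 2) * x)"
proof -
  have "\<forall>\<^sub>F t in at_top. cmod (\<phi> (ray \<sigma> t) x / leading_term l \<sigma> t x) < 2"
    using tendsto_norm[OF phi_over_leading_term_tendsto[OF assms(1,2)]] by (rule order_tendstoD) simp
  then show ?thesis using eventually_ge_at_top[of 1]
  proof eventually_elim
    case (elim t)
    then have "cmod (\<phi> (ray \<sigma> t) x) \<le> 2 * cmod (leading_term l \<sigma> t x)"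
      using leading_term_nonzero[of t l x] by (simp add: norm_divide divide_less_eq)
    with cmod_leading_term_le[OF elim(2) assms(3), of x] show ?case by simp
  qed
qed

lemma green_function_ray_tendsto_0:
  assumes l: "l \<ge> - 1/2" and q: "admissible_potential l q"
    and \<phi>: "\<And>z. is_solution l q b z (\<phi> z)" "phi_asymptotics l b \<phi>"
    and \<psi>: "\<And>z. z \<notin> \<real> \<Longrightarrow> is_solution l q b z (\<psi> z)"
    and W1: "\<And>z x. z \<notin> \<real> \<Longrightarrow> x \<in> einterval 0 b \<Longrightarrow> wronskian (\<psi> z) (\<phi> z) x = 1"
    and dom: "\<And>z. z \<notin> \<real> \<Longrightarrow> in_domain_near_right l q b w (\<psi> z)"
    and w: "limit_circle_right l q b \<Longrightarrow> boundary_function_right l q b w"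
    and x: "x \<in> einterval 0 b"
  shows "((\<lambda>t. \<phi> (ray \<sigma> t) x * \<psi> (ray \<sigma> t) x) \<longlongrightarrow> 0) at_top"
proof -
  have x0: "x > 0" "ereal x < b" using x by (auto simp: einterval_def)
  \<comment> \<open>Any point between \<open>x\<close> and \<open>b\<close> will do as the second
    point of comparison.\<close>
  obtain y where xy: "x < y" "ereal y < b"
    using ereal_dense2[OF x0(2)] by auto
  then have y: "y \<in> einterval 0 b" using x0 by (auto simp: einterval_def)
  \<comment> \<open>\<open>Q\<close> is independent of \<open>t\<close>, so sqrt (t / 2) eventually
    exceeds 160 Q.\<close>
  define Q where "Q = integral {x..y} (\<lambda>t. cmod (potential_term l q t))"
  have "\<forall>\<^sub>F t in at_top. cmod (\<phi> (ray \<sigma> t) y * exp (\<i> * of_real \<sigma> * ray_sqrt \<sigma> t * of_real (y - x)) / \<phi> (ray \<sigma> t) x - 1) < 1/40"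
  proof (rule order_tendstoD(2)[of _ 0])
    show "((\<lambda>t. cmod (\<phi> (ray \<sigma> t) y * exp (\<i> * of_real \<sigma> * ray_sqrt \<sigma> t * of_real (y - x)) / \<phi> (ray \<sigma> t) x - 1)) \<longlongrightarrow> 0) at_top"
      using phi_ray_quotient_tendsto[OF \<phi>(2) \<phi>(2) x y] by (intro tendsto_norm_zero) (simp add: LIM_zero)
  qed simp
  moreover have "\<forall>\<^sub>F t in at_top. \<phi> (ray \<sigma> t) x \<noteq> 0"
    by (rule phi_ray_nonzero[OF \<phi>(2) x])
  moreover have "\<forall>\<^sub>F t in at_top. exp (- 2 * sqrt (t / 2) * (y - x)) < 1/5"
  proof (rule order_tendstoD(2)[of _ 0])
    show "((\<lambda>t. exp (- 2 * sqrt (t / 2) * (y - x))) \<longlongrightarrow> 0) at_top"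
      using xy by real_asymp
  qed simp
  moreover have "filterlim (\<lambda>t. sqrt (t / 2)) at_top at_top" by real_asymp
  then have "\<forall>\<^sub>F t in at_top. sqrt (t / 2) \<ge> 160 * Q" by (simp add: filterlim_at_top)
  ultimately have "\<forall>\<^sub>F t in at_top. cmod (\<phi> (ray \<sigma> t) x * \<psi> (ray \<sigma> t) x) \<le> 2 / sqrt (t / 2)"
    using eventually_gt_at_top[of 0]
  proof eventually_elim
    case (elim t)
    have nonreal: "ray \<sigma> t \<notin> \<real>" using \<sigma> elim by (auto simp: ray_def complex_is_Real_iff)
    have "\<sigma> * Im (dx (\<phi> (ray \<sigma> t)) x / \<phi> (ray \<sigma> t) x) \<le> - sqrt (t / 2) / 2"
    proof (rule Im_log_derivative_le[OF _ q x y _ x0(1) _ \<sigma> _ ray_sqrt_def])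
      show "is_solution l q b ((ray_sqrt \<sigma> t)\<^sup>2) (\<phi> (ray \<sigma> t))"
        using elim \<phi>(1) by (simp add: ray_sqrt_power2)
      show "integral {x..y} (\<lambda>t. cmod (potential_term l q t)) \<le> Q" by (simp add: Q_def)
    qed (use elim xy in auto)
    moreover have "Im (ray \<sigma> t) * Im (dx (\<psi> (ray \<sigma> t)) x * cnj (\<psi> (ray \<sigma> t) x)) \<ge> 0"
      by (rule Im_mult_Im_weyl_solution_nonneg[OF \<psi>[OF nonreal] \<phi>(1) W1[OF nonreal] dom[OF nonreal] w x])
    then have "\<sigma> * Im (dx (\<psi> (ray \<sigma> t)) x * cnj (\<psi> (ray \<sigma> t) x)) \<ge> 0"
      using elim by (simp add: ray_def mult.assoc mult.left_commute[of \<sigma> t] zero_le_mult_iff)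
    ultimately show ?case
      using elim by (intro green_function_bound[OF W1[OF nonreal x] \<sigma>]) auto
  qed
  moreover have "((\<lambda>t. 2 / sqrt (t / 2)) \<longlongrightarrow> 0) at_top" by real_asymp
  ultimately show ?thesis by (rule Lim_null_comparison)
qed

end

text \<open>Outside a disc the asymptotics, uniform in arg z, gives exponential type
  \<open>x\<close> in the square root of |z|, because the power of \<open>z\<close> is at most 1
  there; on the disc continuity suffices.\<close>

lemma phi_in_R_half:
  assumes \<phi>: "phi_asymptotics l b \<phi>" and x: "x \<in> einterval 0 b" and l: "l \<ge> - 1/2"
    and hol: "(\<lambda>z. \<phi> z x) holomorphic_on UNIV"
  shows "(\<lambda>z. \<phi> z x) \<in> R_half"
proof -
  have x0: "x > 0" using x by (simp add: einterval_def)
  obtain r where r: "r \<in> o[at_infinity](\<lambda>z. complex_of_real (exp (x * \<bar>Im (csqrt z)\<bar>)))"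
    and eq: "\<forall>\<^sub>F z in at_infinity. \<phi> z x = z powr (- complex_of_real ((l + 1) / 2)) *
                     (sin (csqrt z * complex_of_real x - complex_of_real (l * pi / 2)) + r z)"
    using \<phi> x by (auto simp: phi_asymptotics_def)
  have "\<forall>\<^sub>F z in at_infinity. cmod (r z) \<le> 1 * cmod (complex_of_real (exp (x * \<bar>Im (csqrt z)\<bar>)))"
    using r by (rule landau_o.smallD) simp
  moreover have "\<forall>\<^sub>F z in at_infinity. cmod z \<ge> 1"
    by (auto simp: eventually_at_infinity)
  ultimately have "\<forall>\<^sub>F z in at_infinity. cmod (\<phi> z x) \<le> 2 * exp (x * cmod z powr (1/2))"
    using eq
  proof eventually_elim
    case (elim z)
    have le: "exp (x * \<bar>Im (csqrt z)\<bar>) \<le> exp (x * cmod z powr (1/2))"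
      using x0 abs_Im_le_cmod[of "csqrt z"] elim(2) by (simp add: powr_half_sqrt)
    have "cmod (z powr (- complex_of_real ((l + 1) / 2))) = cmod z powr (- ((l + 1) / 2))"
      by (simp add: norm_powr_real_powr')
    also have "\<dots> \<le> 1" using elim(2) l powr_mono[of "- ((l + 1) / 2)" 0 "cmod z"]
      by (auto split: if_splits)
    finally have P: "cmod (z powr (- complex_of_real ((l + 1) / 2))) \<le> 1" .
    have "cmod (sin (csqrt z * complex_of_real x - complex_of_real (l * pi / 2))) \<le> exp (x * cmod z powr (1/2))"
    proof (rule order_trans[OF norm_sin_le_exp_Im])
      have "\<bar>Im (csqrt z * complex_of_real x - complex_of_real (l * pi / 2))\<bar> = x * \<bar>Im (csqrt z)\<bar>"
        using x0 by (simp add: abs_mult mult.commute del: csqrt.simps)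
      with le show "exp \<bar>Im (csqrt z * complex_of_real x - complex_of_real (l * pi / 2))\<bar> \<le> exp (x * cmod z powr (1/2))"
        by simp
    qed
    moreover have "cmod (r z) \<le> exp (x * cmod z powr (1/2))"
      using elim(1) order_trans[OF _ le, of "cmod (r z)"] unfolding norm_of_real mult_1 abs_exp_cancel by blast
    ultimately have "cmod (sin (csqrt z * complex_of_real x - complex_of_real (l * pi / 2)) + r z) \<le> 2 * exp (x * cmod z powr (1/2))"
      by (intro norm_triangle_le) simp
    from mult_mono[OF P this] show ?case unfolding elim(3) norm_mult by simp
  qed
  then obtain R where R: "\<And>z. cmod z \<ge> R \<Longrightarrow> cmod (\<phi> z x) \<le> 2 * exp (x * cmod z powr (1/2))"
    by (auto simp: eventually_at_infinity)
  have "compact ((\<lambda>z. \<phi> z x) ` cball 0 R)"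
    using hol by (intro compact_continuous_image) (auto intro: holomorphic_on_imp_continuous_on continuous_on_subset)
  then obtain C where C: "\<And>z. z \<in> cball 0 R \<Longrightarrow> cmod (\<phi> z x) \<le> C"
    using compact_imp_bounded bounded_iff by (metis (no_types, lifting) imageI)
  show ?thesis
  proof (rule R_halfI[OF hol x0])
    show "2 + \<bar>C\<bar> > 0" by simp
    fix z
    have ge1: "exp (x * cmod z powr (1/2)) \<ge> 1" using x0 by simp
    show "cmod (\<phi> z x) \<le> (2 + \<bar>C\<bar>) * exp (x * cmod z powr (1/2))"
    proof (cases "cmod z \<ge> R")
      case True
      have "2 * exp (x * cmod z powr (1/2)) \<le> (2 + \<bar>C\<bar>) * exp (x * cmod z powr (1/2))"
        by (intro mult_right_mono) auto
      with R[OF True] show ?thesis by linarith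
    next
      case False
      then have "cmod (\<phi> z x) \<le> C" by (intro C) auto
      also have "C \<le> (2 + \<bar>C\<bar>) * 1" by simp
      also have "\<dots> \<le> (2 + \<bar>C\<bar>) * exp (x * cmod z powr (1/2))" using ge1 by (intro mult_left_mono) auto
      finally show ?thesis .
    qed
  qed
qed

section \<open>Recovering the potential\<close>

lemma vector_derivative_zero_if_locally_zero:
  assumes "(g has_vector_derivative d) (at x)" "open S" "x \<in> S" "\<And>y. y \<in> S \<Longrightarrow> g y = 0"
  shows "d = 0"
proof -
  have "((\<lambda>_. 0) has_vector_derivative d) (at x)"
    using has_vector_derivative_transform_within_open[OF assms(1-3)] assms(4) by metis
  then show ?thesis using vector_derivative_unique_at has_vector_derivative_const by blast
qed

text \<open>Here \<open>\<phi>'\<close> and \<open>\<theta>'\<close> are the solutions for the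
  second potential, not derivatives. Equal squares make W(\<phi>, \<phi>') vanish, while its
  derivative is (q' - q) \<phi> \<phi>'. The statement is local because the spectral parameter that
  keeps both solutions away from zero is chosen for each point.\<close>

lemma potentials_agree_near:
  assumes sol: "is_solution l q b z \<phi>" "is_solution l q b z \<theta>" "is_solution l q' b z \<phi>'" "is_solution l q' b z \<theta>'"
    and W: "\<And>x. x \<in> einterval 0 b \<Longrightarrow> wronskian \<theta> \<phi> x = 1" "\<And>x. x \<in> einterval 0 b \<Longrightarrow> wronskian \<theta>' \<phi>' x = 1"
    and c: "c \<in> einterval 0 b"
    and rel: "\<And>x. x \<in> {0<..<c} \<Longrightarrow> \<phi>' x * \<theta> x - \<phi> x * \<theta>' x = F * \<phi> x * \<phi>' x"
    and x0: "x0 \<in> {0<..<c}" "\<phi> x0 \<noteq> 0" "\<phi>' x0 \<noteq> 0"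
  shows "\<exists>\<epsilon>>0. negligible {x \<in> ball x0 \<epsilon>. q x \<noteq> q' x}"
proof -
  have sub: "{0<..<c} \<subseteq> einterval 0 b"
    using c by (auto simp: einterval_def zero_ereal_def intro: less_trans[of _ "ereal c"])
  have D: "(\<phi> has_vector_derivative dx \<phi> x) (at x)" "(\<theta> has_vector_derivative dx \<theta> x) (at x)"
    "(\<phi>' has_vector_derivative dx \<phi>' x) (at x)" "(\<theta>' has_vector_derivative dx \<theta>' x) (at x)"
    if "x \<in> {0<..<c}" for x
    using sub that sol by (auto simp: is_solution_iff intro!: has_second_derivative_ae_imp_has_vector_derivative)
  have sq: "\<phi> x * \<phi> x = \<phi>' x * \<phi>' x" if x: "x \<in> {0<..<c}" for x
  proof -
    have "((\<lambda>x. \<phi>' x * \<theta> x - \<phi> x * \<theta>' x - F * (\<phi> x * \<phi>' x)) has_vector_derivative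
        (\<phi>' x * dx \<theta> x + dx \<phi>' x * \<theta> x) - (\<phi> x * dx \<theta>' x + dx \<phi> x * \<theta>' x)
        - F * (\<phi> x * dx \<phi>' x + dx \<phi> x * \<phi>' x)) (at x)"
      by (intro has_vector_derivative_diff has_vector_derivative_mult has_vector_derivative_mult_right D x)
    then have "(\<phi>' x * dx \<theta> x + dx \<phi>' x * \<theta> x) - (\<phi> x * dx \<theta>' x + dx \<phi> x * \<theta>' x)
        - F * (\<phi> x * dx \<phi>' x + dx \<phi> x * \<phi>' x) = 0"
      by (rule vector_derivative_zero_if_locally_zero[of _ _ _ "{0<..<c}"]) (use x rel in auto)
    moreover have "\<theta> x * dx \<phi> x - dx \<theta> x * \<phi> x = 1" "\<theta>' x * dx \<phi>' x - dx \<theta>' x * \<phi>' x = 1"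
      using W x sub by (auto simp: wronskian_def)
    \<comment> \<open>Multiplying the derivative relation by \<open>\<phi> \<phi>'\<close> and
      eliminating \<open>F\<close> through \<open>rel\<close> leaves the two Wronskians; no division
      occurs, so zeros are harmless.\<close>
    ultimately show ?thesis using rel[OF x] by algebra
  qed
  have dsq: "\<phi> x * dx \<phi> x = \<phi>' x * dx \<phi>' x" if x: "x \<in> {0<..<c}" for x
  proof -
    have "((\<lambda>x. \<phi> x * \<phi> x - \<phi>' x * \<phi>' x) has_vector_derivative
        (\<phi> x * dx \<phi> x + dx \<phi> x * \<phi> x) - (\<phi>' x * dx \<phi>' x + dx \<phi>' x * \<phi>' x)) (at x)"
      by (intro has_vector_derivative_diff has_vector_derivative_mult D x)
    then have "(\<phi> x * dx \<phi> x + dx \<phi> x * \<phi> x) - (\<phi>' x * dx \<phi>' x + dx \<phi>' x * \<phi>' x) = 0"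
      by (rule vector_derivative_zero_if_locally_zero[of _ _ _ "{0<..<c}"]) (use x sq in auto)
    then show ?thesis by algebra
  qed
  have wr: "wronskian \<phi> \<phi>' x = 0" if x: "x \<in> {0<..<c}" "\<phi> x \<noteq> 0" for x
  proof -
    \<comment> \<open>Equal squares and equal derivatives of the squares give the Wronskian up to
      the factor \<phi>, which cancels where it is nonzero.\<close>
    have "\<phi> x * wronskian \<phi> \<phi>' x = 0" unfolding wronskian_def using sq[OF x(1)] dsq[OF x(1)] by algebra
    with x show ?thesis by simp
  qed
  have "open ({0<..<c} \<inter> (\<lambda>x. \<phi> x * \<phi>' x) -` (- {0}))"
    using solution_continuous_on[OF sol(1) sub] solution_continuous_on[OF sol(3) sub]
    by (intro continuous_open_preimage continuous_intros) auto
  moreover have "x0 \<in> {0<..<c} \<inter> (\<lambda>x. \<phi> x * \<phi>' x) -` (- {0})" using x0 by simp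
  ultimately obtain \<delta> where \<delta>: "\<delta> > 0" "cball x0 \<delta> \<subseteq> {0<..<c} \<inter> (\<lambda>x. \<phi> x * \<phi>' x) -` (- {0})"
    using open_contains_cball by blast
  define h where "h = (\<lambda>t. \<phi> t * ((potential_term l q' t - z) * \<phi>' t) - (potential_term l q t - z) * \<phi> t * \<phi>' t)"
  have in_I: "t \<in> {0<..<c}" "\<phi> t \<noteq> 0" "\<phi>' t \<noteq> 0" "t \<in> einterval 0 b" if "t \<in> {x0 - \<delta>..x0 + \<delta>}" for t
    using that \<delta>(2) sub by (auto simp: cball_eq_atLeastAtMost)
  note WI = wronskian_identity[OF sol(1,3)[unfolded is_solution_iff], folded h_def]
  have "AE x in lebesgue. x \<in> {x0 - \<delta>..x0 + \<delta>} \<longrightarrow> h x = 0"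
  proof (rule AE_zero_if_interval_integrals_zero)
    show "h absolutely_integrable_on {x0 - \<delta>..x0 + \<delta>}"
      using \<delta> by (intro WI(1) in_I) auto
    fix s t assume st: "x0 - \<delta> \<le> s" "s \<le> t" "t \<le> x0 + \<delta>"
    then have "integral {s..t} h = wronskian \<phi> \<phi>' t - wronskian \<phi> \<phi>' s"
      by (intro WI(2)[symmetric] in_I) auto
    also have "\<dots> = 0" using wr[OF in_I(1,2)] st by simp
    finally show "integral {s..t} h = 0" .
  qed
  then have "AE x in lebesgue. x \<in> ball x0 \<delta> \<longrightarrow> q x = q' x"
  proof eventually_elim
    case (elim x)
    show ?case
    proof
      assume "x \<in> ball x0 \<delta>"
      then have x: "x \<in> {x0 - \<delta>..x0 + \<delta>}" by (auto simp: dist_real_def)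
      \<comment> \<open>The spectral parameter and the centrifugal term are common to both equations
        and drop out.\<close>
      have "h x = \<phi> x * \<phi>' x * of_real (q' x - q x)"
        unfolding h_def potential_term_def by (simp add: algebra_simps)
      then show "q x = q' x" using elim x in_I[OF x] by simp
    qed
  qed
  then obtain N where "N \<in> null_sets lebesgue" "{x. \<not> (x \<in> ball x0 \<delta> \<longrightarrow> q x = q' x)} \<subseteq> N"
    by (auto simp: eventually_ae_filter)
  then have "negligible {x \<in> ball x0 \<delta>. q x \<noteq> q' x}"
    using negligible_subset[of N] by (auto simp: negligible_iff_null_sets)
  with \<delta>(1) show ?thesis by blast
qed

theorem theorem8p5:
  fixes l c :: real and b :: ereal
    and q :: "nat \<Rightarrow> real \<Rightarrow> real"
    and w :: "nat \<Rightarrow> real \<Rightarrow> real"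
    and \<phi> \<theta> :: "nat \<Rightarrow> complex \<Rightarrow> real \<Rightarrow> complex"
    and M :: "nat \<Rightarrow> complex \<Rightarrow> complex"
    and f :: "complex \<Rightarrow> complex"
  assumes l: "l \<ge> - 1/2"
    and b: "0 < b"
    and c: "c \<in> einterval 0 b"
    and q: "\<And>j. j \<in> {0, 1} \<Longrightarrow> admissible_potential l (q j)"
    and bc: "\<And>j. j \<in> {0, 1} \<Longrightarrow> limit_circle_right l (q j) b \<Longrightarrow>
               boundary_function_right l (q j) b (w j)"
    and phi: "\<And>j. j \<in> {0, 1} \<Longrightarrow> real_entire_solution l (q j) b (\<phi> j)"
    and phi_dom: "\<And>j z. j \<in> {0, 1} \<Longrightarrow> in_domain_near_left l b (\<phi> j z)"
    and phi_asymp: "\<And>j. j \<in> {0, 1} \<Longrightarrow> phi_asymptotics l b (\<phi> j)"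
    and theta: "\<And>j. j \<in> {0, 1} \<Longrightarrow> real_entire_solution l (q j) b (\<theta> j)"
    and theta_phi: "\<And>j z x. j \<in> {0, 1} \<Longrightarrow> x \<in> einterval 0 b \<Longrightarrow>
                      wronskian (\<theta> j z) (\<phi> j z) x = 1"
    and theta_growth: "\<And>j x. j \<in> {0, 1} \<Longrightarrow> x \<in> einterval 0 b \<Longrightarrow>
                         (\<lambda>z. \<theta> j z x) \<in> R_half"
    and M: "\<And>j. j \<in> {0, 1} \<Longrightarrow>
              singular_weyl_function l (q j) b (w j) (\<theta> j) (\<phi> j) (M j)"
    and f: "f \<in> R_half"
    and M_diff: "\<And>\<epsilon> \<omega>. \<epsilon> > 0 \<Longrightarrow> \<omega> \<notin> \<real> \<Longrightarrow>
        (\<lambda>t::real. M 1 (of_real t * \<omega>) - M 0 (of_real t * \<omega>) - f (of_real t * \<omega>))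
          \<in> O[at_top](\<lambda>t. complex_of_real
               (exp (- 2 * (c - \<epsilon>) * \<bar>Im (csqrt (of_real t * \<omega>))\<bar>)))"
  shows "AE x in lebesgue. x \<in> {0<..<c} \<longrightarrow> q 0 x = q 1 x"
proof -
  have sub: "x \<in> einterval 0 b" if "x \<in> {0<..<c}" for x
    using c that by (auto simp: einterval_def zero_ereal_def intro: less_trans[of _ "ereal c"])
  have sol: "is_solution l (q j) b z (\<phi> j z)" "is_solution l (q j) b z (\<theta> j z)" if "j \<in> {0, 1}" for j z
    using phi[OF that] theta[OF that] by (auto simp: real_entire_solution_def)
  define \<psi> where "\<psi> = (\<lambda>j z x. \<theta> j z x + M j z * \<phi> j z x)"
  have \<psi>: "is_solution l (q j) b z (\<psi> j z)"
    and W\<psi>: "x \<in> einterval 0 b \<Longrightarrow> wronskian (\<psi> j z) (\<phi> j z) x = 1" if j: "j \<in> {0, 1}" for j z x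
  proof -
    show "is_solution l (q j) b z (\<psi> j z)"
      using is_solution_lincomb[OF sol(2,1)[OF j], of z 1 "M j z"] by (simp add: \<psi>_def)
    assume x: "x \<in> einterval 0 b"
    have "dx (\<psi> j z) x = dx (\<theta> j z) x + M j z * dx (\<phi> j z) x"
      using dx_lincomb_solution[OF sol(2,1)[OF j] x, of 1 z "M j z"] by (simp add: \<psi>_def)
    then show "wronskian (\<psi> j z) (\<phi> j z) x = 1"
      using theta_phi[OF j x, of z] by (simp add: wronskian_def \<psi>_def algebra_simps)
  qed
  have dom: "in_domain_near_right l (q j) b (w j) (\<psi> j z)" if "j \<in> {0, 1}" "z \<notin> \<real>" for j z
    using M[OF that(1)] that(2) by (simp add: singular_weyl_function_def \<psi>_def)
  have green: "((\<lambda>t. \<phi> j (ray \<sigma> t) x * \<psi> j (ray \<sigma> t) x) \<longlongrightarrow> 0) at_top"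
    if "\<sigma> \<in> {1, - 1}" "j \<in> {0, 1}" "x \<in> einterval 0 b" for \<sigma> j x
    by (rule green_function_ray_tendsto_0[OF that(1) l q[OF that(2)] sol(1)[OF that(2)] phi_asymp[OF that(2)]
          \<psi>[OF that(2)] W\<psi>[OF that(2)] dom[OF that(2)] bc[OF that(2)] that(3)])
  have relation: "\<phi> 1 z x * \<theta> 0 z x - \<phi> 0 z x * \<theta> 1 z x = f z * \<phi> 0 z x * \<phi> 1 z x"
    if x: "x \<in> {0<..<c}" for x z
  proof -
    note xb = sub[OF x]
    define F where "F = (\<lambda>z. (\<phi> 1 z x * \<theta> 0 z x - \<phi> 0 z x * \<theta> 1 z x) - f z * (\<phi> 0 z x * \<phi> 1 z x))"
    have "(\<lambda>z. \<phi> j z x) \<in> R_half" if "j \<in> {0, 1}" for j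
      using phi[OF that] xb by (intro phi_in_R_half[OF phi_asymp[OF that] xb l]) (auto simp: real_entire_solution_def)
    then have F: "F \<in> R_half"
      unfolding F_def using theta_growth xb f by (intro R_half_diff R_half_mult) auto
    have lim: "((\<lambda>t. F (ray \<sigma> t)) \<longlongrightarrow> 0) at_top" if \<sigma>: "\<sigma> \<in> {1, - 1}" for \<sigma>
    proof -
      \<comment> \<open>The product of the two solutions grows like exp (2 x sqrt (t / 2)). This
        choice of \<epsilon> leaves the total rate - 2 (c - \<epsilon>) + 2 x = - (c - x), which is
        negative for x < c.\<close>
      define \<epsilon> where "\<epsilon> = (c - x) / 2"
      have \<epsilon>: "\<epsilon> > 0" using x by (simp add: \<epsilon>_def)
      define e where "e t = M 1 (ray \<sigma> t) - M 0 (ray \<sigma> t) - f (ray \<sigma> t)" for t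
      have "\<i> * of_real \<sigma> \<notin> \<real>" using \<sigma> by (auto simp: complex_is_Real_iff)
      from M_diff[OF \<epsilon> this]
      have "e \<in> O[at_top](\<lambda>t. complex_of_real (exp (- 2 * (c - \<epsilon>) * \<bar>Im (csqrt (ray \<sigma> t))\<bar>)))"
        by (simp add: e_def[abs_def] ray_def mult_ac)
      then obtain C where C: "C > 0"
        "\<forall>\<^sub>F t in at_top. cmod (e t) \<le> C * cmod (complex_of_real (exp (- 2 * (c - \<epsilon>) * \<bar>Im (csqrt (ray \<sigma> t))\<bar>)))"
        by (rule landau_o.bigE)
      have "((\<lambda>t. e t * (\<phi> 0 (ray \<sigma> t) x * \<phi> 1 (ray \<sigma> t) x)) \<longlongrightarrow> 0) at_top"
      proof (rule Lim_null_comparison)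
        show "((\<lambda>t. C * exp (- (c - x) * sqrt (t / 2))) \<longlongrightarrow> 0) at_top"
        proof -
          have "((\<lambda>t. C * exp (- d * sqrt (t / 2))) \<longlongrightarrow> 0) at_top" if "d > 0" for d :: real
            using that by real_asymp
          from this[of "c - x"] x show ?thesis by simp
        qed
        have "\<forall>\<^sub>F t in at_top. cmod (\<phi> 0 (ray \<sigma> t) x) \<le> exp (sqrt (t / 2) * x)"
             "\<forall>\<^sub>F t in at_top. cmod (\<phi> 1 (ray \<sigma> t) x) \<le> exp (sqrt (t / 2) * x)"
          by (rule cmod_phi_ray_le[OF \<sigma> phi_asymp xb l]; simp)+
        then show "\<forall>\<^sub>F t in at_top. cmod (e t * (\<phi> 0 (ray \<sigma> t) x * \<phi> 1 (ray \<sigma> t) x)) \<le> C * exp (- (c - x) * sqrt (t / 2))"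
          using C(2) eventually_gt_at_top[of 0]
        proof eventually_elim
          case (elim t)
          have "cmod (e t) \<le> C * exp (- 2 * (c - \<epsilon>) * sqrt (t / 2))"
            using elim(3) unfolding abs_Im_csqrt_ray[OF \<sigma> elim(4)] norm_of_real abs_exp_cancel .
          then have "cmod (e t * (\<phi> 0 (ray \<sigma> t) x * \<phi> 1 (ray \<sigma> t) x)) \<le>
              (C * exp (- 2 * (c - \<epsilon>) * sqrt (t / 2))) * (exp (sqrt (t / 2) * x) * exp (sqrt (t / 2) * x))"
            unfolding norm_mult using elim(1,2) C(1) by (intro mult_mono) auto
          also have "\<dots> = C * exp (- 2 * (c - \<epsilon>) * sqrt (t / 2) + sqrt (t / 2) * x + sqrt (t / 2) * x)"
            by (simp only: exp_add mult.assoc)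
          also have "- 2 * (c - \<epsilon>) * sqrt (t / 2) + sqrt (t / 2) * x + sqrt (t / 2) * x = - (c - x) * sqrt (t / 2)"
            by (simp add: \<epsilon>_def field_simps)
          finally show ?case .
        qed
      qed
      \<comment> \<open>A mixed product is the diagonal Green function times a quotient of solutions
        that tends to 1.\<close>
      moreover have cross: "((\<lambda>t. \<phi> i (ray \<sigma> t) x * \<psi> j (ray \<sigma> t) x) \<longlongrightarrow> 0) at_top" if ij: "i \<in> {0, 1}" "j \<in> {0, 1}" for i j
      proof -
        have "((\<lambda>t. \<phi> i (ray \<sigma> t) x / \<phi> j (ray \<sigma> t) x) \<longlongrightarrow> 1) at_top"
          using phi_ray_quotient_tendsto[OF \<sigma> phi_asymp[OF ij(1)] phi_asymp[OF ij(2)] xb xb] by simp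
        from tendsto_mult[OF this green[OF \<sigma> ij(2) xb]]
        have "((\<lambda>t. \<phi> i (ray \<sigma> t) x / \<phi> j (ray \<sigma> t) x * (\<phi> j (ray \<sigma> t) x * \<psi> j (ray \<sigma> t) x)) \<longlongrightarrow> 0) at_top" by simp
        then show ?thesis
        proof (rule Lim_transform_eventually)
          show "\<forall>\<^sub>F t in at_top. \<phi> i (ray \<sigma> t) x / \<phi> j (ray \<sigma> t) x * (\<phi> j (ray \<sigma> t) x * \<psi> j (ray \<sigma> t) x) =
              \<phi> i (ray \<sigma> t) x * \<psi> j (ray \<sigma> t) x"
            using phi_ray_nonzero[OF \<sigma> phi_asymp[OF ij(2)] xb] by eventually_elim simp
        qed
      qed
      ultimately have "((\<lambda>t. \<phi> 1 (ray \<sigma> t) x * \<psi> 0 (ray \<sigma> t) x - \<phi> 0 (ray \<sigma> t) x * \<psi> 1 (ray \<sigma> t) x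
          + e t * (\<phi> 0 (ray \<sigma> t) x * \<phi> 1 (ray \<sigma> t) x)) \<longlongrightarrow> 0 - 0 + 0) at_top"
        by (intro tendsto_add tendsto_diff) auto
      then show ?thesis by (simp add: F_def e_def \<psi>_def algebra_simps)
    qed
    have "F z = 0"
      using lim[of 1] lim[of "- 1"] by (intro R_half_eq_0[OF F]) (auto simp: ray_def)
    then show ?thesis by (simp add: F_def mult.assoc)
  qed
  have "negligible {x \<in> {0<..<c}. q 0 x \<noteq> q 1 x}" (is "negligible ?S")
  proof (rule locally_negligible_alt[THEN iffD2], rule ballI)
    fix x assume xS: "x \<in> ?S"
    then have x: "x \<in> {0<..<c}" by simp
    \<comment> \<open>A large \<open>t\<close>, depending on \<open>x\<close>, makes both solutions
      nonzero at \<open>x\<close>. Equality of the potentials therefore follows near each point, and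
      local negligibility yields the global statement.\<close>
    have "\<forall>\<^sub>F t in at_top. \<phi> 0 (ray 1 t) x \<noteq> 0" "\<forall>\<^sub>F t in at_top. \<phi> 1 (ray 1 t) x \<noteq> 0"
      using phi_ray_nonzero[of 1 l b "\<phi> 0" x] phi_ray_nonzero[of 1 l b "\<phi> 1" x] phi_asymp sub[OF x] by auto
    then have "\<forall>\<^sub>F t in at_top. \<phi> 0 (ray 1 t) x \<noteq> 0 \<and> \<phi> 1 (ray 1 t) x \<noteq> 0" by eventually_elim simp
    from eventually_happens'[OF trivial_limit_at_top_linorder this]
    obtain t where t: "\<phi> 0 (ray 1 t) x \<noteq> 0" "\<phi> 1 (ray 1 t) x \<noteq> 0" by blast
    have "\<exists>\<epsilon>>0. negligible {y \<in> ball x \<epsilon>. q 0 y \<noteq> q 1 y}"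
      by (rule potentials_agree_near[where \<phi> = "\<phi> 0 (ray 1 t)" and \<theta> = "\<theta> 0 (ray 1 t)"
            and \<phi>' = "\<phi> 1 (ray 1 t)" and \<theta>' = "\<theta> 1 (ray 1 t)", OF sol sol theta_phi theta_phi c relation x t])
         simp_all
    then obtain \<epsilon> where \<epsilon>: "\<epsilon> > 0" "negligible {y \<in> ball x \<epsilon>. q 0 y \<noteq> q 1 y}" by blast
    show "\<exists>U. openin (top_of_set ?S) U \<and> x \<in> U \<and> negligible U"
    proof (intro exI[of _ "?S \<inter> ball x \<epsilon>"] conjI)
      show "openin (top_of_set ?S) (?S \<inter> ball x \<epsilon>)" by (rule openin_open_Int) simp
      show "x \<in> ?S \<inter> ball x \<epsilon>" using xS \<epsilon>(1) by simp
      show "negligible (?S \<inter> ball x \<epsilon>)" by (rule negligible_subset[OF \<epsilon>(2)]) auto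
    qed
  qed
  then have "?S \<in> null_sets lebesgue" by (simp add: negligible_iff_null_sets)
  then show ?thesis by (rule AE_I') auto
qed

end
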